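(* Let $K$ be a knot with an oriented diagram $D\subset S^2$ with a basepoint $p$ on one of its edges, and let $x_1,\dots,x_n$ be variables associated to the regions of $D$. Then Roberts' totally twisted Khovanov homology of $K$, defined over the field $\mathbb F_2(x_1,\dots,x_n)$, is isomorphic as a $\delta$-graded vector space to the $\delta$-graded reduced Khovanov homology of $K$ with coefficients in $\mathbb F_2(x_1,\dots,x_n)$.
   Context: The regions of $D$ are the connected components of $S^2\setminus D$ ($D$ viewed as a $4$-valent plane graph). **Reduced Khovanov complex.** Let $F$ be a field of characteristic $2$. The $\delta$-graded reduced Khovanov complex $(C,d)$ of $D$ over $F$ is the following. To each complete resolution of the crossings of $D$ associate the tensor product of one copy of $A=F[x]/(x^2)$ for each circle of the resolution not containing $p$ (the circle containing $p$ contributes $F=A/(x)$). $C$ is the direct sum of these over all resolutions, with the usual Khovanov grading shifts. The differential $d$ is the usual Khovanov differential, induced on the quotient in which $x$ acts as zero on the circle containing $p$, i.e. the sum over all edges of the cube of resolutions of the merge maps (multiplication of $A$) and split maps ($1\mapsto 1\otimes x+x\otimes 1$, $x\mapsto x\otimes x$). The $\delta$-grading is twice the usual homological grading minus the $q$-grading, where multiplication by $x$ has $q$-degree $-2$; $d$ has $\delta$-degree $2$. **Roberts' totally twisted Khovanov homology.** Take $F=\mathbb F_2(x_1,\dots,x_n)$. For a circle $c$ of a resolution not containing $p$, let $[c]\in F$ be the sum of the variables $x_i$ of the regions of $D$ lying in the component of $S^2\setminus c$ not containing $p$. Let $\partial:C\to C$ be the map that on each resolution is $\sum_c [c]\,x_c$,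 the sum over all circles $c$ of the resolution not containing $p$, where $x_c$ denotes multiplication by $x$ in the tensor factor of $c$. Then $\partial$ also has $\delta$-degree $2$, and $(d+\partial)^2=0$. Roberts' totally twisted Khovanov homology is the $\delta$-graded homology of $(C,d+\partial)$. *)

theory Defs
  imports
    "HOL-Algebra.Module"
    "HOL-Combinatorics.Orbits"
    "HOL-Computational_Algebra.Fraction_Field"
    "HOL-Library.Function_Algebras"
    "HOL-Library.Poly_Mapping"
    "HOL-Library.Set_Algebras"
    "HOL-Library.Z2"
begin

section \<open>Knot diagrams on the sphere\<close>

text \<open>
  A diagram on the oriented sphere is given, up to homeomorphism, by its combinatorial map.
  A dart is a half-edge, thought of as leaving its vertex; \<open>rot\<close> sends a dart to the
  counterclockwise next dart at the same vertex, and \<open>flip\<close> to the other half of the same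
  edge. The basepoint is kept as a vertex of valency two, with darts \<open>basedart\<close> and
  \<open>rot basedart\<close>, subdividing the edge it lies on. This changes neither the regions nor the
  circles of the resolutions, and it makes room for the diagram without crossings.
  All other vertices are crossings. \<open>under\<close> is the set of the darts of the lower strands at
  the crossings, and \<open>outward\<close> the set of the darts along which the orientation of the knot
  leaves their vertex.
\<close>

record 'd diagram =
  darts :: "'d set"
  rot :: "'d \<Rightarrow> 'd"
  flip :: "'d \<Rightarrow> 'd"
  under :: "'d set"
  outward :: "'d set"
  basedart :: 'd

definition base_darts :: "'d diagram \<Rightarrow> 'd set" where
  "base_darts D = {basedart D, rot D (basedart D)}"

definition crossing_darts :: "'d diagram \<Rightarrow> 'd set" where
  "crossing_darts D = darts D - base_darts D"

definition vertices :: "'d diagram \<Rightarrow> 'd set set" where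
  "vertices D = orbit (rot D) ` darts D"

definition crossings :: "'d diagram \<Rightarrow> 'd set set" where
  "crossings D = orbit (rot D) ` crossing_darts D"

definition edges :: "'d diagram \<Rightarrow> 'd set set" where
  "edges D = (\<lambda>d. {d, flip D d}) ` darts D"

text \<open>
  \<open>region D d\<close> is the region to the right of \<open>d\<close>, represented by the darts on its boundary
  that have it on their right. At the vertex of \<open>d\<close> it occupies the corner between \<open>d\<close> and the
  clockwise next dart.
\<close>

definition region :: "'d diagram \<Rightarrow> 'd \<Rightarrow> 'd set" where
  "region D d = orbit (\<lambda>e. rot D (flip D e)) d"

definition regions :: "'d diagram \<Rightarrow> 'd set set" where
  "regions D = region D ` darts D"

text \<open>The strand relation passes along edges and straight through vertices.\<close>

definition straight :: "'d diagram \<Rightarrow> 'd \<Rightarrow> 'd" where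
  "straight D d = (if d \<in> base_darts D then rot D d else rot D (rot D d))"

definition strand_rel :: "'d diagram \<Rightarrow> ('d \<times> 'd) set" where
  "strand_rel D = (\<Union>d\<in>darts D. {(d, flip D d), (d, straight D d)})"

text \<open>
  The assumption \<open>single_component\<close> says that the underlying link is a knot; it makes the
  graph connected, so that the Euler characteristic in \<open>planar\<close> is that of the sphere.
\<close>

locale knot_diagram =
  fixes D :: "'d diagram"
  assumes finite_darts: "finite (darts D)"
    and rot_perm: "bij_betw (rot D) (darts D) (darts D)"
    and flip_closed: "d \<in> darts D \<Longrightarrow> flip D d \<in> darts D"
    and flip_flip: "d \<in> darts D \<Longrightarrow> flip D (flip D d) = d"
    and flip_neq: "d \<in> darts D \<Longrightarrow> flip D d \<noteq> d"
    and base_in: "basedart D \<in> darts D"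
    and base_rot_neq: "rot D (basedart D) \<noteq> basedart D"
    and base_bivalent: "rot D (rot D (basedart D)) = basedart D"
    and crossing_four: "d \<in> crossing_darts D \<Longrightarrow> rot D (rot D (rot D (rot D d))) = d"
    and crossing_not_two: "d \<in> crossing_darts D \<Longrightarrow> rot D (rot D d) \<noteq> d"
    and under_subset: "under D \<subseteq> crossing_darts D"
    and under_alternates: "d \<in> crossing_darts D \<Longrightarrow> rot D d \<in> under D \<longleftrightarrow> d \<notin> under D"
    and outward_subset: "outward D \<subseteq> darts D"
    and outward_flip: "d \<in> darts D \<Longrightarrow> flip D d \<in> outward D \<longleftrightarrow> d \<notin> outward D"
    and outward_straight: "d \<in> darts D \<Longrightarrow> straight D d \<in> outward D \<longleftrightarrow> d \<notin> outward D"
    and single_component: "d \<in> darts D \<Longrightarrow> (basedart D, d) \<in> (strand_rel D)\<^sup>*"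
    and planar: "int (card (vertices D)) - int (card (edges D)) + int (card (regions D)) = 2"

text \<open>
  At a positive crossing the outgoing lower dart comes counterclockwise next after the outgoing
  upper dart.
\<close>

definition n_plus :: "'d diagram \<Rightarrow> nat" where
  "n_plus D = card {v \<in> crossings D.
     \<exists>d\<in>v. d \<notin> under D \<and> d \<in> outward D \<and> rot D d \<in> outward D}"

definition n_minus :: "'d diagram \<Rightarrow> nat" where
  "n_minus D = card {v \<in> crossings D.
     \<exists>d\<in>v. d \<notin> under D \<and> d \<in> outward D \<and> rot D d \<notin> outward D}"

section \<open>Resolutions\<close>

text \<open>
  A complete resolution is given by the set \<open>s\<close> of its 1-resolved crossings, and
  \<open>smooth D s d\<close> is the dart to which \<open>d\<close> is joined at its vertex. The 0-resolution merges the
  two corners swept out by the upper strand when it is turned counterclockwise: it joins each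
  lower dart to the counterclockwise next dart. The 1-resolution joins it to the clockwise next
  dart.
\<close>

definition smooth :: "'d diagram \<Rightarrow> 'd set set \<Rightarrow> 'd \<Rightarrow> 'd" where
  "smooth D s d =
     (if d \<in> base_darts D then rot D d
      else if d \<in> under D \<longleftrightarrow> orbit (rot D) d \<notin> s then rot D d
      else rot D (rot D (rot D d)))"

definition circle_rel :: "'d diagram \<Rightarrow> 'd set set \<Rightarrow> ('d \<times> 'd) set" where
  "circle_rel D s = (\<Union>d\<in>darts D. {(d, flip D d), (d, smooth D s d)})"

definition circles :: "'d diagram \<Rightarrow> 'd set set \<Rightarrow> 'd set set" where
  "circles D s = darts D // (circle_rel D s)\<^sup>*"

definition free_circles :: "'d diagram \<Rightarrow> 'd set set \<Rightarrow> 'd set set" where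
  "free_circles D s = {c \<in> circles D s. basedart D \<notin> c}"

section \<open>The reduced Khovanov complex\<close>

text \<open>
  The tensor product of copies of \<open>A = F[x]/(x\<^sup>2)\<close> belonging to the resolution \<open>s\<close> has as
  basis the pairs \<open>(s, X)\<close> with \<open>X\<close> a set of circles not containing the basepoint; the pair
  stands for the tensor product of \<open>x\<close> over the circles in \<open>X\<close> and of \<open>1\<close> over all others.
  A chain is the function giving its coefficients in this basis.
\<close>

type_synonym 'd generator = "'d set set \<times> 'd set set"

type_synonym ('d, 'k) chain = "'d generator \<Rightarrow> 'k"

definition generators :: "'d diagram \<Rightarrow> 'd generator set" where
  "generators D = {(s, X). s \<subseteq> crossings D \<and> X \<subseteq> free_circles D s}"

text \<open>
  The circle through the basepoint contributes degree 0, so that the reduced homology of the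
  unknot lies in bidegree \<open>(0, 0)\<close>.
\<close>

definition h_grading :: "'d diagram \<Rightarrow> 'd generator \<Rightarrow> int" where
  "h_grading D = (\<lambda>(s, X). int (card s) - int (n_minus D))"

definition q_grading :: "'d diagram \<Rightarrow> 'd generator \<Rightarrow> int" where
  "q_grading D = (\<lambda>(s, X). int (card (free_circles D s - X)) - int (card X)
     + int (card s) + int (n_plus D) - 2 * int (n_minus D))"

definition delta_grading :: "'d diagram \<Rightarrow> 'd generator \<Rightarrow> int" where
  "delta_grading D g = 2 * h_grading D g - q_grading D g"

definition chains :: "'d diagram \<Rightarrow> int \<Rightarrow> ('d, 'k::field) chain set" where
  "chains D k = {f. \<forall>g. f g \<noteq> 0 \<longrightarrow> g \<in> generators D \<and> delta_grading D g = k}"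

text \<open>
  Coefficients of the multiplication \<open>A \<otimes> A \<rightarrow> A\<close> and of the comultiplication
  \<open>A \<rightarrow> A \<otimes> A\<close> in the basis \<open>1\<close> (\<open>False\<close>), \<open>x\<close> (\<open>True\<close>).
\<close>

definition merge_coeff :: "bool \<Rightarrow> bool \<Rightarrow> bool \<Rightarrow> bool" where
  "merge_coeff a b c \<longleftrightarrow> \<not> (a \<and> b) \<and> (c \<longleftrightarrow> a \<or> b)"

definition split_coeff :: "bool \<Rightarrow> bool \<Rightarrow> bool \<Rightarrow> bool" where
  "split_coeff a b c \<longleftrightarrow> (if a then b \<and> c else b \<noteq> c)"

text \<open>
  \<open>khovanov_edge D g g'\<close> says that the matrix entry from \<open>g\<close> to \<open>g'\<close> of the differential is
  1; otherwise it is 0. Both \<open>g\<close> and \<open>g'\<close> are taken to be generators, whose circle through the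
  basepoint carries the label \<open>1\<close>. Dropping all terms with label \<open>x\<close> there is the passage to the
  quotient.
\<close>

definition khovanov_edge :: "'d diagram \<Rightarrow> 'd generator \<Rightarrow> 'd generator \<Rightarrow> bool" where
  "khovanov_edge D = (\<lambda>(s, X) (s', X').
     (\<exists>v. v \<in> crossings D \<and> v \<notin> s \<and> s' = insert v s) \<and>
     X \<inter> (circles D s \<inter> circles D s') = X' \<inter> (circles D s \<inter> circles D s') \<and>
     ((\<exists>a b c. a \<noteq> b \<and> circles D s - circles D s' = {a, b} \<and> circles D s' - circles D s = {c} \<and>
         merge_coeff (a \<in> X) (b \<in> X) (c \<in> X')) \<or>
      (\<exists>a b c. b \<noteq> c \<and> circles D s - circles D s' = {a} \<and> circles D s' - circles D s = {b, c} \<and>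
         split_coeff (a \<in> X) (b \<in> X') (c \<in> X'))))"

text \<open>The coefficient field is meant to have characteristic 2, so there are no signs.\<close>

definition khovanov_d :: "'d diagram \<Rightarrow> ('d, 'k::field) chain \<Rightarrow> ('d, 'k) chain" where
  "khovanov_d D f = (\<lambda>g'. if g' \<in> generators D
     then (\<Sum>g | g \<in> generators D \<and> khovanov_edge D g g'. f g) else 0)"

section \<open>The twisted differential\<close>

text \<open>
  Two regions lie in the same component of the complement of a circle \<open>c\<close> of the resolution \<open>s\<close>
  iff one gets from one to the other by crossing edges that are not part of \<open>c\<close> and by passing
  between the two arcs that replace a crossing. If \<open>d\<close> is joined to \<open>rot D d\<close>, that passage
  connects the corners between \<open>d\<close> and its clockwise neighbour and between \<open>rot D d\<close> and
  \<open>rot D (rot D d)\<close>.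
\<close>

definition complement_rel ::
  "'d diagram \<Rightarrow> 'd set set \<Rightarrow> 'd set \<Rightarrow> ('d set \<times> 'd set) set" where
  "complement_rel D s c =
     {(region D d, region D (flip D d)) | d. d \<in> darts D \<and> d \<notin> c} \<union>
     {(region D d, region D (rot D (rot D d))) | d.
        d \<in> crossing_darts D \<and> smooth D s d = rot D d}"

text \<open>
  For a circle not containing the basepoint, the regions at the basepoint, such as
  \<open>region D (basedart D)\<close>, lie in the component containing the basepoint.
\<close>

definition far_regions :: "'d diagram \<Rightarrow> 'd set set \<Rightarrow> 'd set \<Rightarrow> 'd set set" where
  "far_regions D s c =
     {r \<in> regions D. (region D (basedart D), r) \<notin> (complement_rel D s c)\<^sup>*}"

definition circle_weight ::
  "'d diagram \<Rightarrow> ('d set \<Rightarrow> 'k::field) \<Rightarrow> 'd set set \<Rightarrow> 'd set \<Rightarrow> 'k" where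
  "circle_weight D w s c = (\<Sum>r\<in>far_regions D s c. w r)"

definition x_mult :: "'d set \<Rightarrow> ('d, 'k::field) chain \<Rightarrow> ('d, 'k) chain" where
  "x_mult c f = (\<lambda>(s, X). if c \<in> X then f (s, X - {c}) else 0)"

definition twist :: "'d diagram \<Rightarrow> ('d set \<Rightarrow> 'k::field) \<Rightarrow> ('d, 'k) chain \<Rightarrow> ('d, 'k) chain" where
  "twist D w f = (\<lambda>(s, X). if (s, X) \<in> generators D
     then (\<Sum>c\<in>free_circles D s. circle_weight D w s c * x_mult c f (s, X)) else 0)"

section \<open>Graded homology\<close>

text \<open>
  The homology in degree \<open>k\<close> of an endomorphism \<open>T\<close> of degree 2 of the chains, as a vector
  space of cosets. Its addition is the elementwise sum of sets; the boundaries are added in the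
  scalar multiplication for the sake of the scalar 0. The fields \<open>mult\<close> and \<open>one\<close> of the record
  play no role in a module.
\<close>

definition boundaries ::
  "'d diagram \<Rightarrow> (('d, 'k::field) chain \<Rightarrow> ('d, 'k) chain) \<Rightarrow> int \<Rightarrow> ('d, 'k) chain set" where
  "boundaries D T k = T ` chains D (k - 2)"

definition homology ::
  "'d diagram \<Rightarrow> (('d, 'k::field) chain \<Rightarrow> ('d, 'k) chain) \<Rightarrow> int \<Rightarrow>
     ('k, ('d, 'k) chain set) module" where
  "homology D T k =
     \<lparr>carrier = {z +o boundaries D T k | z. z \<in> chains D k \<and> T z = 0},
      monoid.mult = undefined, monoid.one = undefined,
      ring.zero = boundaries D T k,
      ring.add = (\<lambda>U V. U + V),
      module.smult = (\<lambda>a U. (\<lambda>f g. a * f g) ` U + boundaries D T k)\<rparr>"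

definition graded_iso :: "(int \<Rightarrow> ('k, 'v) module) \<Rightarrow> (int \<Rightarrow> ('k, 'w) module) \<Rightarrow> bool" where
  "graded_iso M N \<longleftrightarrow> (\<forall>k. \<exists>\<phi>.
     \<phi> \<in> iso (add_monoid (M k)) (add_monoid (N k)) \<and>
     (\<forall>a. \<forall>v\<in>carrier (M k). \<phi> (a \<odot>\<^bsub>M k\<^esub> v) = a \<odot>\<^bsub>N k\<^esub> \<phi> v))"

definition reduced_khovanov_homology ::
  "'d diagram \<Rightarrow> int \<Rightarrow> ('k::field, ('d, 'k) chain set) module" where
  "reduced_khovanov_homology D = homology D (khovanov_d D)"

definition twisted_homology ::
  "'d diagram \<Rightarrow> ('d set \<Rightarrow> 'k::field) \<Rightarrow> int \<Rightarrow> ('k, ('d, 'k) chain set) module" where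
  "twisted_homology D w = homology D (\<lambda>f. khovanov_d D f + twist D w f)"

text \<open>
  The field of rational functions over the field with two elements, in variables indexed by the
  type \<open>'r\<close>. The linear order serves only to make the polynomial ring an integral domain for the
  type class system.
\<close>

type_synonym 'r ratfun = "(('r \<Rightarrow>\<^sub>0 nat) \<Rightarrow>\<^sub>0 bit) fract"

definition ratfun_var :: "'r::linorder \<Rightarrow> 'r ratfun" where
  "ratfun_var i = Fract (Poly_Mapping.single (Poly_Mapping.single i 1) 1) 1"

end

(*
  In characteristic 2 write x_d for multiplication by x on the circle through the dart d. For
  every crossing v let E_v be the saddle map at v, read in both directions; it commutes with all
  x_d. Hence identities between the E_v need only be checked on the chains 1_s, where E_v is 1
  for a merge and x_p + x_q for a split (p, q opposite darts at v). This gives E_v E_u = E_u E_v,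
  E_v^2 = x_p + x_q and E_v^3 = 0. The differential d is the sum of the parts of the E_v that
  add v to the resolution; let h_v be the other part, which has delta-degree 0. Then
  d h_v + h_v d = E_v^2, so that conjugation by the involutions 1 + w_v h_v turns d into
  d + sum_v w_v E_v^2.

  It remains to write the twist in this form. By the Jordan curve theorem, crossing an edge d
  changes the contribution of a region to the twist by x_d. As the diagram is a knot, every dart
  d is reached from the basepoint, where x_d = 0, by running along the strand, and passing the
  crossing v changes x_d by E_v^2.

  Planarity enters through the Euler characteristic: every even set of edges is the boundary of
  a set of regions. Applied to a circle this is the Jordan curve theorem; applied to all edges
  it gives a checkerboard colouring, hence an orientation of all circles of all resolutions,
  which excludes saddles from one circle to one circle.
*)
theory Submission
  imports Defs
begin

text \<open>The relation E_v^3 = 0 is what removes the quadratic term of the conjugation. With h =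
  h_v and w = w_v, (1 + w h) d (1 + w h) = d + w (h d + d h) + w^2 h d h, and h d h = h h d + h
  E_v^2 = 0, because h h = 0 and h E_v^2 is a part of E_v^3. Since h_v commutes with E_u^2, the
  conjugations for different crossings can be applied one after another. The map h_v has
  delta-degree 0 because it lowers the homological degree by 1 and the q-degree by 2: by 1 through
  the saddle and by 1 through the shift. Reading saddles in both directions has a price: E_v E_u =
  E_u E_v concerns more than the faces of the cube, namely also squares in which a saddle is read
  backwards. The gain is that all resolutions are treated alike, so that one count of circles and
  one exceptional configuration settle every case.\<close>

section \<open>Orbits of permutations and parity of finite sets\<close>

text \<open>\<open>orbit f x\<close> only collects iterates with at least one application of
  \<open>f\<close>, so \<open>x\<close> belongs to it only if the iteration returns. By pigeonhole
  two iterates agree, and injectivity cancels the common part.\<close>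

lemma bij_betw_self_in_orbit:
  assumes "bij_betw f A A" "finite A" "x \<in> A"
  shows "x \<in> orbit f x"
proof -
  have closed: "(f ^^ n) y \<in> A" if "y \<in> A" for n y
    using that assms(1) by (induction n) (auto simp: bij_betw_apply)
  have "\<not> inj (\<lambda>n. (f ^^ n) x)"
    using closed[OF assms(3)] assms(2) by (meson finite_subset image_subsetI infinite_UNIV_nat inj_on_finite finite_imageD)
  then obtain i j where ij: "i < j" "(f ^^ i) x = (f ^^ j) x"
    by (metis (mono_tags, lifting) injI linorder_neqE_nat)
  have inj: "(f ^^ i) y = (f ^^ i) z \<Longrightarrow> y \<in> A \<Longrightarrow> z \<in> A \<Longrightarrow> y = z" for y z i
  proof (induction i)
    case (Suc i)
    then have "(f ^^ i) y = (f ^^ i) z"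
      using closed assms(1) by (auto dest: inj_onD[OF bij_betw_imp_inj_on])
    then show ?case using Suc by blast
  qed auto
  have "(f ^^ i) ((f ^^ (j - i)) x) = (f ^^ i) x"
    using ij by (metis funpow_add le_add_diff_inverse less_imp_le o_apply)
  then have "(f ^^ (j - i)) x = x"
    using inj closed[OF assms(3)] assms(3) by blast
  then show ?thesis
    using ij(1) unfolding orbit_altdef by (metis (mono_tags, lifting) mem_Collect_eq zero_less_diff)
qed

lemma orbit_subset_invariant:
  assumes "f ` A \<subseteq> A" "x \<in> A"
  shows "orbit f x \<subseteq> A"
proof
  show "y \<in> A" if "y \<in> orbit f x" for y
    using that by induction (use assms in auto)
qed

lemma bij_betw_orbit_eq:
  assumes "bij_betw f A A" "finite A" "x \<in> A" "y \<in> orbit f x"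
  shows "orbit f y = orbit f x"
  using assms(4)
proof induction
  case base
  then show ?case
    using bij_betw_self_in_orbit[OF assms(1-3)] by (simp add: self_in_orbit_step)
next
  case (step y)
  then have "y \<in> A"
    using orbit_subset_invariant[of f A x] assms by (auto simp: bij_betw_def)
  with step show ?case
    using bij_betw_self_in_orbit[OF assms(1,2)] by (metis self_in_orbit_step)
qed

text \<open>Both \<open>flip\<close> and \<open>smooth\<close> are such involutions; the parity
  serves to show that circles meet every vertex evenly and that arcs have two ends.\<close>

lemma even_card_involution:
  assumes "finite A" "\<And>x. x \<in> A \<Longrightarrow> f x \<in> A \<and> f (f x) = x \<and> f x \<noteq> x"
  shows "even (card A)"
  using assms
proof (induction "card A" arbitrary: A rule: less_induct)
  case less
  show ?case
  proof (cases "A = {}")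
    case False
    then obtain x where x: "x \<in> A" by blast
    let ?B = "A - {x, f x}"
    have "card A = card ?B + 2"
    proof -
      have "{x, f x} \<subseteq> A" "card {x, f x} = 2" using x less.prems(2)[OF x] by auto
      then show ?thesis
        using card_mono[OF less.prems(1), of "{x, f x}"] by (simp add: card_Diff_subset)
    qed
    moreover have "even (card ?B)"
    proof (rule less.hyps)
      show "card ?B < card A" using calculation by simp
      show "finite ?B" using less.prems by simp
      fix y assume "y \<in> ?B"
      then show "f y \<in> ?B \<and> f (f y) = y \<and> f y \<noteq> y"
        using less.prems(2)[of y] less.prems(2)[OF x] by auto
    qed
    ultimately show ?thesis by simp
  qed simp
qed

lemma odd_card_sym_diff:
  assumes "finite A" "finite B"
  shows "odd (card (sym_diff A B)) \<longleftrightarrow> odd (card A) \<noteq> odd (card B)"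
proof -
  have "card A = card (A - B) + card (A \<inter> B)" "card B = card (B - A) + card (A \<inter> B)"
    using assms card_Int_Diff[of A B] card_Int_Diff[of B A] by (simp_all add: Int_commute)
  moreover have "card (sym_diff A B) = card (A - B) + card (B - A)"
    using assms by (intro card_Un_disjoint) auto
  ultimately show ?thesis by presburger
qed

section \<open>Darts, vertices and regions of a diagram\<close>

context knot_diagram
begin

lemma rot_in: "d \<in> darts D \<Longrightarrow> rot D d \<in> darts D"
  using rot_perm by (auto simp: bij_betw_def)

lemma base_darts_subset: "base_darts D \<subseteq> darts D"
  using base_in rot_in by (auto simp: base_darts_def)

lemma rot_base: "d \<in> base_darts D \<Longrightarrow> rot D d \<in> base_darts D \<and> rot D (rot D d) = d \<and> rot D d \<noteq> d"
  using base_bivalent base_rot_neq by (auto simp: base_darts_def)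

lemma rot_inj: "d \<in> darts D \<Longrightarrow> e \<in> darts D \<Longrightarrow> rot D d = rot D e \<longleftrightarrow> d = e"
  using rot_perm by (auto simp: bij_betw_def inj_on_def)

lemma crossing_dartsD: "d \<in> crossing_darts D \<Longrightarrow> d \<in> darts D"
  by (simp add: crossing_darts_def)

lemma rot_crossing: "d \<in> crossing_darts D \<Longrightarrow> rot D d \<in> crossing_darts D"
  using rot_base rot_in rot_inj base_darts_subset unfolding crossing_darts_def
  by (metis Diff_iff subsetD)

lemma darts_cases:
  assumes "d \<in> darts D"
  obtains "d \<in> base_darts D" "d \<notin> crossing_darts D" | "d \<in> crossing_darts D" "d \<notin> base_darts D"
  using assms by (auto simp: crossing_darts_def)

lemma self_in_vertex: "d \<in> darts D \<Longrightarrow> d \<in> orbit (rot D) d"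
  using bij_betw_self_in_orbit[OF rot_perm finite_darts] .

lemma vertex_eq: "d \<in> darts D \<Longrightarrow> e \<in> orbit (rot D) d \<Longrightarrow> orbit (rot D) e = orbit (rot D) d"
  using bij_betw_orbit_eq[OF rot_perm finite_darts] .

lemma vertex_rot: "d \<in> darts D \<Longrightarrow> orbit (rot D) (rot D d) = orbit (rot D) d"
  by (simp add: vertex_eq orbit.base)

lemma vertex_subset: "d \<in> darts D \<Longrightarrow> orbit (rot D) d \<subseteq> darts D"
  by (rule orbit_subset_invariant) (use rot_in in auto)

lemma bij_flip: "bij_betw (flip D) (darts D) (darts D)"
  by (rule bij_betwI[of _ _ _ "flip D"]) (auto simp: flip_closed flip_flip)

lemma bij_region: "bij_betw (\<lambda>e. rot D (flip D e)) (darts D) (darts D)"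
  using bij_betw_trans[OF bij_flip rot_perm] by (simp add: o_def)

lemma region_rot_flip: "d \<in> darts D \<Longrightarrow> region D (rot D (flip D d)) = region D d"
  unfolding region_def
  by (rule bij_betw_orbit_eq[OF bij_region finite_darts]) (auto intro: orbit.base)

text \<open>The corner counterclockwise of \<open>d\<close> lies to the right of
  \<open>rot D d\<close> and to the left of \<open>d\<close>, hence to the right of
  \<open>flip D d\<close>. So turning at a vertex amounts to crossing an edge.\<close>

lemma region_rot: "d \<in> darts D \<Longrightarrow> region D (rot D d) = region D (flip D d)"
  using region_rot_flip[of "flip D d"] by (simp add: flip_closed flip_flip)

lemma crossing_orbit:
  assumes "d \<in> crossing_darts D"
  shows "orbit (rot D) d = {d, rot D d, rot D (rot D d), rot D (rot D (rot D d))}"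
proof
  show "orbit (rot D) d \<subseteq> {d, rot D d, rot D (rot D d), rot D (rot D (rot D d))}"
    by (rule orbit_subset_invariant) (use crossing_four[OF assms] in auto)
  show "{d, rot D d, rot D (rot D d), rot D (rot D (rot D d))} \<subseteq> orbit (rot D) d"
    using self_in_vertex assms by (auto simp: crossing_darts_def intro: orbit.intros)
qed

text \<open>Fixed points of the rotation are excluded by the alternation of upper and lower darts,
  cycles of length two by \<open>crossing_not_two\<close>.\<close>

lemma crossing_distinct:
  assumes "d \<in> crossing_darts D"
  shows "distinct [d, rot D d, rot D (rot D d), rot D (rot D (rot D d))]"
proof -
  have "rot D d \<noteq> d" using under_alternates[OF assms] by metis
  moreover have "rot D (rot D d) \<noteq> d" by (rule crossing_not_two[OF assms])
  ultimately show ?thesis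
    using rot_crossing[OF assms] assms crossing_dartsD rot_inj crossing_not_two
      rot_crossing[OF rot_crossing[OF assms]] under_alternates
    by (simp, metis)
qed

section \<open>Circles of resolutions\<close>

lemma smooth_cases:
  assumes "d \<in> darts D"
  shows "smooth D s d = rot D d \<or> (d \<in> crossing_darts D \<and> smooth D s d = rot D (rot D (rot D d)))"
  using assms by (auto simp: smooth_def crossing_darts_def)

lemma smooth_base: "d \<in> base_darts D \<Longrightarrow> smooth D s d = rot D d"
  by (simp add: smooth_def)

lemma smooth_crossing:
  "d \<in> crossing_darts D \<Longrightarrow> smooth D s d = (if d \<in> under D \<longleftrightarrow> orbit (rot D) d \<notin> s then rot D d
      else rot D (rot D (rot D d)))"
  by (simp add: smooth_def crossing_darts_def)

lemma smooth_in: "d \<in> darts D \<Longrightarrow> smooth D s d \<in> darts D"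
  using smooth_cases rot_in by metis

text \<open>Neighbouring darts at a crossing lie on different strands, so if a dart is turned
  counterclockwise, its new neighbour is turned clockwise, that is, back.\<close>

lemma smooth_smooth: "d \<in> darts D \<Longrightarrow> smooth D s (smooth D s d) = d"
proof (erule darts_cases)
  assume "d \<in> base_darts D"
  then show ?thesis using rot_base by (simp add: smooth_base)
next
  assume d: "d \<in> crossing_darts D"
  note r = rot_crossing[OF d] rot_crossing[OF rot_crossing[OF d]] rot_crossing[OF rot_crossing[OF rot_crossing[OF d]]]
  show ?thesis
    using d r by (simp add: smooth_crossing vertex_rot crossing_dartsD under_alternates crossing_four)
qed

lemma smooth_neq: "d \<in> darts D \<Longrightarrow> smooth D s d \<noteq> d"
proof (erule darts_cases)
  assume "d \<in> base_darts D"
  then show ?thesis using rot_base by (simp add: smooth_base)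
next
  assume d: "d \<in> crossing_darts D"
  then show ?thesis using crossing_distinct[OF d] by (auto simp: smooth_crossing)
qed

lemma vertex_smooth: "d \<in> darts D \<Longrightarrow> orbit (rot D) (smooth D s d) = orbit (rot D) d"
  using smooth_cases[of d s] by (auto simp: vertex_rot rot_in)

definition circle :: "'d set set \<Rightarrow> 'd \<Rightarrow> 'd set" where
  "circle s d = (circle_rel D s)\<^sup>* `` {d}"

lemma sym_circle_rel: "sym (circle_rel D s)"
  by (rule symI) (auto simp: circle_rel_def flip_flip flip_closed smooth_smooth smooth_in)

lemma equiv_circle: "equiv UNIV ((circle_rel D s)\<^sup>*)"
  by (simp add: equiv_def refl_rtrancl sym_rtrancl sym_circle_rel trans_rtrancl)

lemma circles_eq: "circles D s = circle s ` darts D"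
  by (auto simp: circles_def circle_def quotient_def)

lemma self_in_circle: "d \<in> circle s d"
  by (simp add: circle_def)

lemma circle_eq_iff: "circle s d = circle s e \<longleftrightarrow> e \<in> circle s d"
  unfolding circle_def using equiv_circle[of s]
  by (metis (no_types, lifting) Image_singleton_iff UNIV_I eq_equiv_class_iff)

lemma circle_eqI: "e \<in> circle s d \<Longrightarrow> circle s e = circle s d"
  using circle_eq_iff by metis

text \<open>The form in which circles are bounded from above throughout: by exhibiting a set closed
  under both moves.\<close>

lemma circle_least:
  assumes "d \<in> K" "\<And>e. e \<in> K \<Longrightarrow> e \<in> darts D \<Longrightarrow> flip D e \<in> K"
    "\<And>e. e \<in> K \<Longrightarrow> e \<in> darts D \<Longrightarrow> smooth D s e \<in> K"
  shows "circle s d \<subseteq> K"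
proof
  fix e assume "e \<in> circle s d"
  then have "(d, e) \<in> (circle_rel D s)\<^sup>*" by (simp add: circle_def)
  then show "e \<in> K"
    by induction (use assms in \<open>auto simp: circle_rel_def\<close>)
qed

lemma circle_subset: "d \<in> darts D \<Longrightarrow> circle s d \<subseteq> darts D"
  by (rule circle_least) (auto simp: flip_closed smooth_in)

lemma circle_flip: "d \<in> darts D \<Longrightarrow> circle s (flip D d) = circle s d"
  by (rule circle_eqI) (auto simp: circle_def circle_rel_def)

lemma circle_smooth: "d \<in> darts D \<Longrightarrow> circle s (smooth D s d) = circle s d"
  by (rule circle_eqI) (auto simp: circle_def circle_rel_def)

lemma circle_closed:
  assumes "c \<in> circles D s" "d \<in> c"
  shows "d \<in> darts D" "flip D d \<in> c" "smooth D s d \<in> c" "c = circle s d"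
proof -
  obtain e where e: "e \<in> darts D" "c = circle s e" using assms by (auto simp: circles_eq)
  then show d: "d \<in> darts D" using assms(2) circle_subset by auto
  show c: "c = circle s d" using e assms by (simp add: circle_eqI)
  show "flip D d \<in> c" "smooth D s d \<in> c" unfolding c
    using d circle_flip circle_smooth self_in_circle by metis+
qed

lemma finite_circles: "finite (circles D s)"
  by (simp add: circles_eq finite_darts)

section \<open>Planarity\<close>

text \<open>The dual graph is connected: the strand visits every dart, and by
  \<open>region_rot\<close> each turn at a vertex is again the crossing of an edge.\<close>

lemma region_connected:
  assumes step: "\<And>d. d \<in> darts D \<Longrightarrow> P (region D d) \<Longrightarrow> P (region D (flip D d))"
    and "d \<in> darts D" "e \<in> darts D" "P (region D d)"
  shows "P (region D e)"
proof -
  have flip: "P (region D (flip D d)) \<longleftrightarrow> P (region D d)" if "d \<in> darts D" for d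
    using step that flip_closed flip_flip by metis
  have rot: "P (region D (rot D d)) \<longleftrightarrow> P (region D d)" if "d \<in> darts D" for d
    using flip that by (simp add: region_rot)
  have base: "e \<in> darts D \<and> P (region D e) = P (region D (basedart D))" if "e \<in> darts D" for e
    using single_component[OF that]
  proof induction
    case base
    then show ?case using base_in by simp
  next
    case (step y z)
    then have y: "y \<in> darts D" "z = flip D y \<or> z = rot D y \<or> z = rot D (rot D y)"
      by (auto simp: strand_rel_def straight_def)
    with step.IH show ?case
      using flip rot rot_in flip_closed by metis
  qed
  show ?thesis using base[OF assms(2)] base[OF assms(3)] assms(4) by simp
qed

text \<open>Sets of edges, written as sets of darts: the cellular 1-chains over the field with two
  elements. Accordingly \<open>odd_vertices\<close> is the boundary map to 0-chains,
  \<open>region_boundary\<close> the boundary map from 2-chains, and \<open>even_sets\<close> below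
  the space of 1-cycles.\<close>

definition flip_closed_sets :: "'d set set" where
  "flip_closed_sets = {c. c \<subseteq> darts D \<and> (\<forall>d\<in>c. flip D d \<in> c)}"

definition odd_vertices :: "'d set \<Rightarrow> 'd set set" where
  "odd_vertices c = {v \<in> vertices D. odd (card (c \<inter> v))}"

definition region_boundary :: "'d set set \<Rightarrow> 'd set" where
  "region_boundary R = {d \<in> darts D. (region D d \<in> R) \<noteq> (region D (flip D d) \<in> R)}"

lemma finite_flip_closed_sets: "finite flip_closed_sets"
  by (rule finite_subset[of _ "Pow (darts D)"]) (auto simp: flip_closed_sets_def finite_darts)

lemma sym_diff_flip_closed:
  assumes "a \<in> flip_closed_sets" "b \<in> flip_closed_sets"
  shows "sym_diff a b \<in> flip_closed_sets"
proof -
  have "flip D d \<in> a \<longleftrightarrow> d \<in> a" "flip D d \<in> b \<longleftrightarrow> d \<in> b" if "d \<in> darts D" for d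
    using assms flip_flip[OF that] unfolding flip_closed_sets_def by (metis (mono_tags, lifting) mem_Collect_eq)+
  then show ?thesis using assms unfolding flip_closed_sets_def by blast
qed

lemma odd_vertices_sym_diff:
  assumes "a \<subseteq> darts D" "b \<subseteq> darts D"
  shows "odd_vertices (sym_diff a b) = sym_diff (odd_vertices a) (odd_vertices b)"
proof -
  have fin: "finite a" "finite b" using assms finite_darts finite_subset by auto
  have "odd (card (sym_diff a b \<inter> v)) \<longleftrightarrow> odd (card (a \<inter> v)) \<noteq> odd (card (b \<inter> v))" for v
  proof -
    have "sym_diff a b \<inter> v = sym_diff (a \<inter> v) (b \<inter> v)" by blast
    then show ?thesis using odd_card_sym_diff[of "a \<inter> v" "b \<inter> v"] fin by simp
  qed
  then show ?thesis unfolding odd_vertices_def by blast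
qed

lemma card_flip_closed_sets: "card flip_closed_sets = 2 ^ card (edges D)"
proof -
  have "bij_betw Union (Pow (edges D)) flip_closed_sets"
  proof (rule bij_betw_byWitness[where f' = "\<lambda>c. {e \<in> edges D. e \<subseteq> c}"])
    show "\<forall>a\<in>Pow (edges D). {e \<in> edges D. e \<subseteq> \<Union>a} = a"
    proof
      fix a assume a: "a \<in> Pow (edges D)"
      have "e \<in> a" if sub: "e \<in> edges D" "e \<subseteq> \<Union>a" for e
      proof -
        obtain d where d: "d \<in> darts D" "e = {d, flip D d}" using \<open>e \<in> edges D\<close> by (auto simp: edges_def)
        then obtain f where "f \<in> a" "d \<in> f" using sub(2) by blast
        moreover then obtain d' where "d' \<in> darts D" "f = {d', flip D d'}" using a by (auto simp: edges_def)
        ultimately show ?thesis using d flip_flip by (auto simp: insert_commute)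
      qed
      then show "{e \<in> edges D. e \<subseteq> \<Union>a} = a" using a by auto
    qed
    show "\<forall>c\<in>flip_closed_sets. \<Union>{e \<in> edges D. e \<subseteq> c} = c"
      by (auto simp: flip_closed_sets_def edges_def)
    show "\<Union> ` Pow (edges D) \<subseteq> flip_closed_sets"
    proof safe
      fix a assume a: "a \<subseteq> edges D"
      show "\<Union> a \<in> flip_closed_sets"
        unfolding flip_closed_sets_def
      proof (intro CollectI conjI subsetI ballI)
        fix d assume "d \<in> \<Union>a"
        then obtain f where f: "f \<in> a" "d \<in> f" by blast
        with a obtain d' where "d' \<in> darts D" "f = {d', flip D d'}" by (auto simp: edges_def)
        with f show "d \<in> darts D" "flip D d \<in> \<Union>a" using flip_flip flip_closed by auto
      qed
    qed
    show "(\<lambda>c. {e \<in> edges D. e \<subseteq> c}) ` flip_closed_sets \<subseteq> Pow (edges D)" by auto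
  qed
  then have "card flip_closed_sets = card (Pow (edges D))" by (simp add: bij_betw_same_card)
  then show ?thesis by (simp add: card_Pow edges_def finite_darts)
qed

text \<open>The symmetric difference also covers a loop, whose two darts cancel at their common
  vertex.\<close>

lemma odd_vertices_edge:
  assumes "d \<in> darts D"
  shows "odd_vertices {d, flip D d} = sym_diff {orbit (rot D) d} {orbit (rot D) (flip D d)}"
proof -
  have mem: "e \<in> v \<longleftrightarrow> v = orbit (rot D) e" if "e \<in> darts D" "v \<in> vertices D" for e v
  proof -
    obtain e' where "e' \<in> darts D" "v = orbit (rot D) e'"
      using \<open>v \<in> vertices D\<close> by (auto simp: vertices_def)
    then show ?thesis using vertex_eq[of e' e] self_in_vertex[OF \<open>e \<in> darts D\<close>] by metis
  qed
  have V: "orbit (rot D) e \<in> vertices D" if "e \<in> darts D" for e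
    using that by (simp add: vertices_def)
  have "{d, flip D d} \<inter> v = (if v = orbit (rot D) d then {d} else {}) \<union>
     (if v = orbit (rot D) (flip D d) then {flip D d} else {})" if "v \<in> vertices D" for v
    using mem[OF assms that] mem[OF flip_closed[OF assms] that] by auto
  then have "odd (card ({d, flip D d} \<inter> v)) \<longleftrightarrow> v \<in> sym_diff {orbit (rot D) d} {orbit (rot D) (flip D d)}"
    if "v \<in> vertices D" for v
    using that flip_neq[OF assms] by auto
  then show ?thesis using V assms flip_closed unfolding odd_vertices_def by blast
qed

lemma edge_flip_closed: "d \<in> darts D \<Longrightarrow> {d, flip D d} \<in> flip_closed_sets"
  by (auto simp: flip_closed_sets_def flip_closed flip_flip)

text \<open>Follow the strand from the basepoint to \<open>e\<close> and add up mod 2 the edges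
  passed; going straight through a vertex changes nothing.\<close>

lemma odd_vertices_pair:
  assumes "e \<in> darts D"
  shows "\<exists>c\<in>flip_closed_sets. odd_vertices c = sym_diff {orbit (rot D) (basedart D)} {orbit (rot D) e}"
proof -
  have "e \<in> darts D \<and> (\<exists>c\<in>flip_closed_sets. odd_vertices c =
    sym_diff {orbit (rot D) (basedart D)} {orbit (rot D) e})"
    using single_component[OF assms]
  proof induction
    case base
    have "{} \<in> flip_closed_sets" "odd_vertices {} = {}"
      by (auto simp: flip_closed_sets_def odd_vertices_def)
    then show ?case using base_in by force
  next
    case (step y z)
    then obtain c where c: "y \<in> darts D" "c \<in> flip_closed_sets"
        "odd_vertices c = sym_diff {orbit (rot D) (basedart D)} {orbit (rot D) y}" by blast
    consider "z = flip D y" | "z = straight D y" using step by (auto simp: strand_rel_def)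
    then show ?case
    proof cases
      case 1
      let ?c = "sym_diff c {y, flip D y}"
      have "?c \<in> flip_closed_sets"
        using c by (intro sym_diff_flip_closed edge_flip_closed)
      moreover have "odd_vertices ?c = sym_diff {orbit (rot D) (basedart D)} {orbit (rot D) z}"
      proof -
        have "c \<subseteq> darts D" "{y, flip D y} \<subseteq> darts D"
          using c flip_closed by (auto simp: flip_closed_sets_def)
        then show ?thesis
          using odd_vertices_sym_diff[of c "{y, flip D y}"] c odd_vertices_edge[of y] 1 by auto
      qed
      ultimately show ?thesis using c(1) flip_closed 1 by metis
    next
      case 2
      then show ?thesis using c by (auto simp: straight_def vertex_rot rot_in)
    qed
  qed
  then show ?thesis by blast
qed

text \<open>Paths from the base vertex to the points of \<open>U\<close> are added up. The base
  vertex is the common end of these paths, so its parity is left open.\<close>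

lemma odd_vertices_onto:
  assumes "finite U" "U \<subseteq> vertices D - {orbit (rot D) (basedart D)}"
  shows "\<exists>c\<in>flip_closed_sets. odd_vertices c - {orbit (rot D) (basedart D)} = U"
  using assms
proof induction
  case empty
  have "{} \<in> flip_closed_sets" "odd_vertices {} = {}"
    by (auto simp: flip_closed_sets_def odd_vertices_def)
  then show ?case by force
next
  case (insert u U)
  then obtain c where c: "c \<in> flip_closed_sets" "odd_vertices c - {orbit (rot D) (basedart D)} = U" by auto
  obtain e where e: "e \<in> darts D" "u = orbit (rot D) e" using insert by (auto simp: vertices_def)
  then obtain b where b: "b \<in> flip_closed_sets"
      "odd_vertices b = sym_diff {orbit (rot D) (basedart D)} {u}"
    using odd_vertices_pair by blast
  have "odd_vertices (sym_diff c b) = sym_diff (odd_vertices c) (odd_vertices b)"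
    using b c by (intro odd_vertices_sym_diff) (auto simp: flip_closed_sets_def)
  then have "odd_vertices (sym_diff c b) - {orbit (rot D) (basedart D)} = insert u U"
    using b c insert by auto
  then show ?case using sym_diff_flip_closed b c by metis
qed

definition even_sets :: "'d set set" where
  "even_sets = {c \<in> flip_closed_sets. odd_vertices c = {}}"

lemma finite_vertices: "finite (vertices D)" and finite_regions: "finite (regions D)"
  by (simp_all add: vertices_def regions_def finite_darts)

text \<open>Rank and nullity as a count: with a chosen preimage \<open>f U\<close> for each
  \<open>U\<close>, the sums of \<open>f U\<close> and a cycle \<open>k\<close> are pairwise
  distinct, since \<open>U\<close> can be read off from the odd vertices and then \<open>k\<close>
  by cancelling.\<close>

lemma card_even_sets: "card even_sets * 2 ^ (card (vertices D) - 1) \<le> 2 ^ card (edges D)"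
proof -
  let ?v0 = "orbit (rot D) (basedart D)"
  let ?P = "Pow (vertices D - {?v0})"
  have "\<forall>U\<in>?P. \<exists>c\<in>flip_closed_sets. odd_vertices c - {?v0} = U"
  proof
    fix U assume "U \<in> ?P"
    moreover from this have "finite U"
      by (meson Diff_subset PowD finite_subset finite_vertices)
    ultimately show "\<exists>c\<in>flip_closed_sets. odd_vertices c - {?v0} = U"
      using odd_vertices_onto by blast
  qed
  then obtain f where f: "\<And>U. U \<in> ?P \<Longrightarrow> f U \<in> flip_closed_sets \<and> odd_vertices (f U) - {?v0} = U"
    by metis
  let ?g = "\<lambda>(U, k). sym_diff (f U) k"
  have odd: "odd_vertices (sym_diff (f U) k) = odd_vertices (f U)" if "U \<in> ?P" "k \<in> even_sets" for U k
  proof -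
    have "odd_vertices (sym_diff (f U) k) = sym_diff (odd_vertices (f U)) (odd_vertices k)"
      using f[OF that(1)] that(2) by (intro odd_vertices_sym_diff) (auto simp: flip_closed_sets_def even_sets_def)
    then show ?thesis using that(2) by (simp add: even_sets_def)
  qed
  have "inj_on ?g (?P \<times> even_sets)"
  proof (rule inj_onI, clarify)
    fix U k U' k'
    assume a: "U \<subseteq> vertices D - {?v0}" "k \<in> even_sets" "U' \<subseteq> vertices D - {?v0}" "k' \<in> even_sets"
      and eq: "sym_diff (f U) k = sym_diff (f U') k'"
    have odd_eq: "odd_vertices (f U) = odd_vertices (f U')"
      using odd[OF PowI[OF a(1)] a(2)] odd[OF PowI[OF a(3)] a(4)] unfolding eq by (rule trans[OF sym])
    have "U = odd_vertices (f U) - {?v0}"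
      by (rule f[OF PowI[OF a(1)], THEN conjunct2, symmetric])
    also have "\<dots> = U'"
      unfolding odd_eq by (rule f[OF PowI[OF a(3)], THEN conjunct2])
    finally have "U = U'" .
    moreover have "k = k'" if "sym_diff (f U) k = sym_diff (f U) k'" using that by blast
    ultimately show "U = U' \<and> k = k'" using eq by simp
  qed
  moreover have "?g ` (?P \<times> even_sets) \<subseteq> flip_closed_sets"
  proof clarify
    fix U k assume "U \<subseteq> vertices D - {?v0}" "k \<in> even_sets"
    then show "sym_diff (f U) k \<in> flip_closed_sets"
      using f[of U] by (intro sym_diff_flip_closed) (simp_all add: even_sets_def)
  qed
  ultimately have "card (?P \<times> even_sets) \<le> card flip_closed_sets"
    using finite_flip_closed_sets card_inj_on_le by blast
  moreover have "card ?P = 2 ^ (card (vertices D) - 1)"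
    using finite_vertices base_in by (simp add: card_Pow vertices_def)
  ultimately show ?thesis by (simp add: card_cartesian_product card_flip_closed_sets mult.commute)
qed

text \<open>Going once around a vertex, membership in \<open>R\<close> changes an even number of
  times: the two sets of corners compared, \<open>?A\<close> and \<open>?B\<close>, differ by a
  rotation and so have equally many elements.\<close>

lemma region_boundary_even: "region_boundary R \<in> even_sets"
proof -
  have "region_boundary R \<in> flip_closed_sets"
    by (auto simp: flip_closed_sets_def region_boundary_def flip_closed flip_flip)
  moreover have "even (card (region_boundary R \<inter> orbit (rot D) e))" if e: "e \<in> darts D" for e
  proof -
    let ?v = "orbit (rot D) e"
    let ?A = "{d \<in> ?v. region D d \<in> R}" and ?B = "{d \<in> ?v. region D (rot D d) \<in> R}"
    have v: "?v \<subseteq> darts D" using vertex_subset[OF e] .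
    then have fin: "finite ?v" using finite_darts finite_subset by blast
    have bij: "rot D ` ?v = ?v"
      by (rule endo_inj_surj[OF fin]) (use v rot_inj in \<open>auto intro: orbit.step simp: inj_on_def\<close>)
    have "?A = rot D ` ?B" using bij by auto
    moreover have "inj_on (rot D) ?B" using v rot_inj by (auto simp: inj_on_def)
    ultimately have "card ?A = card ?B" by (simp add: card_image)
    moreover have "region_boundary R \<inter> ?v = sym_diff ?A ?B"
      using v by (auto simp: region_boundary_def region_rot)
    ultimately show ?thesis using odd_card_sym_diff[of ?A ?B] fin by simp
  qed
  ultimately show ?thesis by (auto simp: even_sets_def odd_vertices_def vertices_def)
qed

text \<open>Vanishing of the first homology of the sphere, by counting. A set of regions avoiding
  the base region is determined by its boundary, because regions are connected across edges. So
  there are 2^(F - 1) boundaries, and by Euler's formula this is the upper bound 2^(E - V + 1) for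
  the number of cycles.\<close>

lemma even_set_is_boundary:
  assumes "c \<in> even_sets"
  obtains R where "R \<subseteq> regions D" "c = region_boundary R"
proof -
  let ?P = "Pow (regions D - {region D (basedart D)})"
  have inj: "inj_on region_boundary ?P"
  proof (rule inj_onI)
    fix R R' assume a: "R \<in> ?P" "R' \<in> ?P" "region_boundary R = region_boundary R'"
    have "region D e \<in> R \<longleftrightarrow> region D e \<in> R'" if "e \<in> darts D" for e
    proof (rule region_connected[where P = "\<lambda>r. r \<in> R \<longleftrightarrow> r \<in> R'" and d = "basedart D"])
      show "(region D (flip D d) \<in> R) = (region D (flip D d) \<in> R')"
        if "d \<in> darts D" "(region D d \<in> R) = (region D d \<in> R')" for d
        using a(3) that by (auto simp: region_boundary_def set_eq_iff)
    qed (use a that base_in in auto)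
    then show "R = R'" using a by (auto simp: regions_def)
  qed
  have fin: "finite even_sets"
    using finite_flip_closed_sets by (simp add: even_sets_def)
  have pos: "card (vertices D) > 0" "card (regions D) > 0"
    using base_in finite_vertices finite_regions by (auto simp: card_gt_0_iff vertices_def regions_def)
  have cP: "card ?P = 2 ^ (card (regions D) - 1)"
    using finite_regions base_in by (simp add: card_Pow regions_def)
  have "(card (regions D) - 1) + (card (vertices D) - 1) = card (edges D)"
    using planar pos by linarith
  then have "card even_sets * 2 ^ (card (vertices D) - 1) \<le> card ?P * 2 ^ (card (vertices D) - 1)"
    using card_even_sets cP by (simp add: power_add[symmetric])
  then have "card even_sets \<le> card (region_boundary ` ?P)"
    using inj by (simp add: card_image)
  then have "region_boundary ` ?P = even_sets"
    using fin region_boundary_even by (intro card_seteq) auto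
  then show ?thesis using assms that by (metis (no_types, lifting) Diff_subset PowD image_iff subset_trans)
qed

text \<open>The smoothing pairs off the darts of \<open>c\<close> at each vertex, so
  \<open>c\<close> is a cycle and hence a boundary.\<close>

lemma two_colouring:
  assumes "c \<subseteq> darts D" "\<And>d. d \<in> c \<Longrightarrow> flip D d \<in> c" "\<And>d. d \<in> c \<Longrightarrow> smooth D s d \<in> c"
  obtains R where "\<And>d. d \<in> darts D \<Longrightarrow> (region D d \<in> R) \<noteq> (region D (flip D d) \<in> R) \<longleftrightarrow> d \<in> c"
proof -
  have "even (card (c \<inter> orbit (rot D) e))" if "e \<in> darts D" for e
  proof (rule even_card_involution[where f = "smooth D s"])
    show "finite (c \<inter> orbit (rot D) e)" using assms finite_darts finite_subset by blast
    fix x assume x: "x \<in> c \<inter> orbit (rot D) e"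
    then have "x \<in> darts D" using assms by blast
    moreover from this have "smooth D s x \<in> orbit (rot D) e"
      using x self_in_vertex[of "smooth D s x"] vertex_smooth[of x s] vertex_eq[OF that, of x] smooth_in by auto
    ultimately show "smooth D s x \<in> c \<inter> orbit (rot D) e \<and> smooth D s (smooth D s x) = x \<and> smooth D s x \<noteq> x"
      using x assms(3) smooth_smooth smooth_neq by auto
  qed
  then have "c \<in> even_sets"
    using assms by (auto simp: even_sets_def flip_closed_sets_def odd_vertices_def vertices_def)
  then obtain R where "c = region_boundary R" by (rule even_set_is_boundary)
  then show ?thesis using that[of R] by (auto simp: region_boundary_def)
qed

section \<open>The two sides of a circle\<close>

lemma rot_rot_under: "d \<in> crossing_darts D \<Longrightarrow> rot D (rot D d) \<in> under D \<longleftrightarrow> d \<in> under D"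
  using under_alternates rot_crossing by blast

lemma flip_in_circle_iff: "d \<in> darts D \<Longrightarrow> flip D d \<in> circle s e \<longleftrightarrow> d \<in> circle s e"
  using circle_flip by (metis circle_eq_iff)

lemma smooth_in_circle_iff: "d \<in> darts D \<Longrightarrow> smooth D s d \<in> circle s e \<longleftrightarrow> d \<in> circle s e"
  using circle_smooth by (metis circle_eq_iff)

lemma complement_rel_smooth:
  "d \<in> crossing_darts D \<Longrightarrow> smooth D s d = rot D d \<Longrightarrow>
     (region D d, region D (rot D (rot D d))) \<in> complement_rel D s c"
  by (auto simp: complement_rel_def)

text \<open>A smoothed crossing is symmetric under the half turn, because opposite darts lie on the
  same strand.\<close>

lemma smooth_opposite:
  assumes "d \<in> crossing_darts D"
  shows "smooth D s (rot D (rot D d)) = rot D (rot D (smooth D s d))"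
  using assms crossing_dartsD[OF assms]
  by (simp add: smooth_crossing rot_crossing rot_rot_under vertex_rot rot_in)

lemma sym_complement_rel:
  assumes "c \<in> circles D s"
  shows "sym (complement_rel D s c)"
proof (rule symI)
  fix a b assume "(a, b) \<in> complement_rel D s c"
  then consider d where "d \<in> darts D" "d \<notin> c" "a = region D d" "b = region D (flip D d)"
    | d where "d \<in> crossing_darts D" "smooth D s d = rot D d" "a = region D d"
        "b = region D (rot D (rot D d))"
    by (auto simp: complement_rel_def)
  then show "(b, a) \<in> complement_rel D s c"
  proof cases
    case 1
    then have "flip D d \<notin> c" "flip D d \<in> darts D"
      using circle_closed[OF assms, of "flip D d"] flip_flip flip_closed by metis+
    then have "(region D (flip D d), region D (flip D (flip D d))) \<in> complement_rel D s c"
      unfolding complement_rel_def by blast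
    then show ?thesis using 1 flip_flip by simp
  next
    case 2
    then show ?thesis
      using complement_rel_smooth[of "rot D (rot D d)" s c]
      by (simp add: rot_crossing smooth_opposite crossing_four)
  qed
qed

text \<open>The passage between the two arcs is a walk across \<open>d\<close> and then
  \<open>rot D d\<close>. These are joined by the smoothing, so \<open>c\<close> contains both or
  neither and the colour changes twice or not at all.\<close>

lemma complement_rel_colour:
  assumes "c \<in> circles D s" "(a, b) \<in> complement_rel D s c"
    and R: "\<And>d. d \<in> darts D \<Longrightarrow> (region D d \<in> R) \<noteq> (region D (flip D d) \<in> R) \<longleftrightarrow> d \<in> c"
  shows "a \<in> R \<longleftrightarrow> b \<in> R"
proof -
  from assms consider d where "d \<in> darts D" "d \<notin> c" "a = region D d" "b = region D (flip D d)"
    | d where "d \<in> crossing_darts D" "smooth D s d = rot D d" "a = region D d"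
        "b = region D (rot D (rot D d))"
    by (auto simp: complement_rel_def)
  then show ?thesis
  proof cases
    case 1
    then show ?thesis using R by blast
  next
    case 2
    then have d: "d \<in> darts D" "rot D d \<in> darts D" by (auto simp: crossing_darts_def rot_in)
    have "d \<in> c \<longleftrightarrow> rot D d \<in> c"
      using circle_closed[OF assms(1)] 2(2) smooth_smooth[OF d(1), of s] by metis
    then show ?thesis using R[OF d(1)] R[OF d(2)] 2 region_rot d by auto
  qed
qed

text \<open>The Jordan curve theorem for \<open>c\<close>. The colouring shows that the two regions
  at a dart of \<open>c\<close> are on different sides; walking along \<open>c\<close> shows that
  there is no third side, so the region at the basepoint belongs to one of these two.\<close>

lemma far_regions_flip:
  assumes c: "c \<in> free_circles D s" and d: "d \<in> darts D"
  shows "(region D d \<in> far_regions D s c) \<noteq> (region D (flip D d) \<in> far_regions D s c) \<longleftrightarrow> d \<in> c"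
proof -
  let ?E = "(complement_rel D s c)\<^sup>*"
  let ?b = "region D (basedart D)"
  have c': "c \<in> circles D s" "basedart D \<notin> c" using c by (auto simp: free_circles_def)
  have eqv: "equiv UNIV ?E"
    using sym_complement_rel[OF c'(1)] by (simp add: equiv_def refl_rtrancl sym_rtrancl trans_rtrancl)
  have symE: "(y, x) \<in> ?E" if "(x, y) \<in> ?E" for x y
    using that eqv by (meson equivE symD)
  have far: "region D e \<in> far_regions D s c \<longleftrightarrow> (?b, region D e) \<notin> ?E" if "e \<in> darts D" for e
    using that by (simp add: far_regions_def regions_def)
  have cross: "(region D e, region D (flip D e)) \<in> ?E" if "e \<in> darts D" "e \<notin> c" for e
    using that by (auto simp: complement_rel_def)
  show ?thesis
  proof (cases "d \<in> c")
    case False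
    then have "(?b, region D d) \<in> ?E \<longleftrightarrow> (?b, region D (flip D d)) \<in> ?E"
      using cross[OF d] symE by (meson rtrancl_trans)
    then show ?thesis using False far d flip_closed by simp
  next
    case True
    obtain R where R: "\<And>d. d \<in> darts D \<Longrightarrow> (region D d \<in> R) \<noteq> (region D (flip D d) \<in> R) \<longleftrightarrow> d \<in> c"
      using two_colouring[of c s] circle_closed[OF c'(1)] by (metis subsetI)
    have inv: "a \<in> R \<longleftrightarrow> b \<in> R" if "(a, b) \<in> ?E" for a b
      using that by induction (use complement_rel_colour[OF c'(1) _ R] in blast)+
    have not_both: "\<not> ((?b, region D d) \<in> ?E \<and> (?b, region D (flip D d)) \<in> ?E)"
      using inv R[OF d] True by blast
    \<comment> \<open>Walking along \<open>c\<close> shows that every region at \<open>c\<close> lies on the same side as one of the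
       two regions at \<open>d\<close>; hence so does every region.\<close>
    let ?U = "\<lambda>r. (r, region D d) \<in> ?E \<or> (r, region D (flip D d)) \<in> ?E"
    let ?Q = "\<lambda>e. ?U (region D e) \<and> ?U (region D (flip D e))"
    have trE: "?U y" if "(x, y) \<in> ?E" "?U x" for x y
      using that symE by (blast intro: rtrancl_trans)
    have "c = circle s d" by (rule circle_closed[OF c'(1) True])
    also have "\<dots> \<subseteq> {e \<in> c. ?Q e}"
    proof (rule circle_least)
      show "d \<in> {e \<in> c. ?Q e}" using True by auto
      show "flip D e \<in> {e \<in> c. ?Q e}" if "e \<in> {e \<in> c. ?Q e}" "e \<in> darts D" for e
        using that flip_flip circle_closed(2)[OF c'(1)] by auto
      show "smooth D s e \<in> {e \<in> c. ?Q e}" if e: "e \<in> {e \<in> c. ?Q e}" "e \<in> darts D" for e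
      proof -
        let ?f = "smooth D s e"
        have f: "?f \<in> c" "?f \<in> darts D" using e circle_closed(3)[OF c'(1)] smooth_in by auto
        \<comment> \<open>At the basepoint there is no passage between arcs, but a free circle does
          not go there.\<close>
        have "e \<notin> base_darts D"
        proof
          assume "e \<in> base_darts D"
          then have "basedart D = e \<or> basedart D = ?f"
            using smooth_base base_bivalent unfolding base_darts_def by (metis empty_iff insert_iff)
          then show False using e f c' by auto
        qed
        then have cr: "e \<in> crossing_darts D" using e by (simp add: crossing_darts_def)
        \<comment> \<open>Where \<open>g\<close> is joined to \<open>rot D g\<close>, the corner
          between them is the region on one side of both; the regions on the other side are
          connected by the passage.\<close>
        have *: "(region D g, region D (flip D (rot D g))) \<in> ?E \<and> region D (rot D g) = region D (flip D g)"
          if "g \<in> crossing_darts D" "smooth D s g = rot D g" for g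
        proof -
          have g: "g \<in> darts D" "rot D g \<in> darts D" using that by (auto simp: crossing_darts_def rot_in)
          then show ?thesis
            using complement_rel_smooth[OF that, of c] region_rot[OF g(1)] region_rot[OF g(2)] by auto
        qed
        show ?thesis
        proof (cases "?f = rot D e")
          case True
          then have "?U (region D (flip D ?f))" "region D ?f = region D (flip D e)"
            using *[OF cr True] e(1) trE by auto
          then show ?thesis using e f by simp
        next
          case False
          then have r: "?f = rot D (rot D (rot D e))" using smooth_cases[OF e(2)] by blast
          then have "rot D ?f = e" "?f \<in> crossing_darts D"
            using cr by (simp_all add: crossing_four rot_crossing)
          moreover have "smooth D s ?f = e" using e smooth_smooth by simp
          ultimately have "(region D ?f, region D (flip D e)) \<in> ?E" "region D e = region D (flip D ?f)"
            using *[of ?f] by auto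
          then have "?U (region D ?f)" "region D e = region D (flip D ?f)"
            using e(1) trE[OF symE] by auto
          then show ?thesis using e f by simp
        qed
      qed
    qed
    finally have near: "?Q e" if "e \<in> c" for e using that by blast
    have "?U ?b"
    proof (rule region_connected[where P = ?U, OF _ d base_in])
      show "?U (region D (flip D e))" if "e \<in> darts D" "?U (region D e)" for e
      proof (cases "e \<in> c")
        case True
        then show ?thesis using near by blast
      next
        case False
        then show ?thesis using that(2) symE[OF cross[OF that(1) False]] by (blast intro: rtrancl_trans)
      qed
    qed auto
    then show ?thesis using True not_both far d flip_closed by auto
  qed
qed

lemma far_regions_base: "region D (basedart D) \<notin> far_regions D s c"
  by (simp add: far_regions_def)

section \<open>Changing the resolution of a crossing\<close>

text \<open>Toggling, instead of inserting, lets one statement cover a saddle and its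
  reversal.\<close>

definition toggle :: "'d set \<Rightarrow> 'd set set \<Rightarrow> 'd set set" where
  "toggle v s = (if v \<in> s then s - {v} else insert v s)"

lemma toggle_toggle [simp]: "toggle v (toggle v s) = s"
  by (auto simp: toggle_def)

lemma toggle_commute: "toggle u (toggle v s) = toggle v (toggle u s)"
  by (auto simp: toggle_def)

lemma in_toggle: "u \<in> toggle v s \<longleftrightarrow> (if u = v then u \<notin> s else u \<in> s)"
  by (auto simp: toggle_def)

lemma smooth_toggle_other: "orbit (rot D) e \<noteq> v \<Longrightarrow> smooth D (toggle v s) e = smooth D s e"
  by (simp add: smooth_def in_toggle)

lemma smooth_toggle:
  assumes "e \<in> crossing_darts D"
  shows "smooth D (toggle (orbit (rot D) e) s) e = rot D (rot D (smooth D s e))"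
  using assms by (simp add: smooth_crossing in_toggle crossing_four)

abbreviation opp :: "'d \<Rightarrow> 'd" where
  "opp d \<equiv> rot D (rot D d)"

text \<open>The circle of \<open>s\<close> through \<open>d\<close> meets the crossing only in
  \<open>d\<close> and its partner \<open>?m\<close>. Cut open there it is an arc, which the change
  of the smoothing leaves intact.\<close>

lemma circle_subset_toggle:
  assumes d: "d \<in> crossing_darts D" and ne: "opp d \<notin> circle s d"
  shows "circle s d \<subseteq> circle (toggle (orbit (rot D) d) s) d"
proof -
  let ?v = "orbit (rot D) d" and ?s = "toggle (orbit (rot D) d) s"
  let ?m = "smooth D s d" and ?K = "circle (toggle (orbit (rot D) d) s) d \<inter> circle s d"
  have dd: "d \<in> darts D" using d by (rule crossing_dartsD)
  have vert: "?v = {d, ?m, opp d, opp ?m}"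
    using crossing_orbit[OF d] smooth_cases[OF dd, of s]
    by (elim disjE conjE) (simp_all add: crossing_four[OF d] insert_commute)
  have m: "?m \<in> circle s d" using circle_smooth[OF dd] self_in_circle by metis
  have "opp ?m \<notin> circle s d"
  proof
    assume "opp ?m \<in> circle s d"
    then have "smooth D s (smooth D s (opp d)) \<in> circle s d"
      using circle_smooth[of "smooth D s (opp d)" s] circle_eq_iff self_in_circle
      by (metis d dd rot_in smooth_in smooth_opposite)
    then show False using ne dd smooth_smooth rot_in by simp
  qed
  then have v: "e = d \<or> e = ?m" if "e \<in> ?K" "orbit (rot D) e = ?v" "e \<in> darts D" for e
    using that vert ne self_in_vertex[of e] by auto
  have K: "?K \<subseteq> darts D" using circle_subset[OF dd] by blast
  then have fin: "finite ?K" using finite_darts finite_subset by blast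
  have flip: "flip D e \<in> ?K" if "e \<in> ?K" for e
    using that K flip_in_circle_iff[of e] by blast
  have sm: "smooth D s e \<in> ?K" if "e \<in> ?K" "e \<noteq> d" "e \<noteq> ?m" for e
  proof -
    have e: "e \<in> darts D" using that K by blast
    then have "smooth D ?s e = smooth D s e"
      using v[OF that(1) _ e] that by (metis smooth_toggle_other)
    then show ?thesis
      using that(1) smooth_in_circle_iff[OF e, of s d] smooth_in_circle_iff[OF e, of ?s d] by simp
  qed
  \<comment> \<open>An arc has two ends: if \<open>?K\<close> contained \<open>d\<close> but not
    \<open>?m\<close>, then \<open>flip\<close> would pair off all of \<open>?K\<close>, and the
    smoothing all of \<open>?K\<close> except \<open>d\<close>.\<close>
  have "?m \<in> ?K"
  proof (rule ccontr)
    assume nm: "?m \<notin> ?K"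
    have "even (card ?K)"
      using fin by (rule even_card_involution[where f = "flip D"]) (use flip flip_flip flip_neq K in blast)
    moreover have "even (card (?K - {d}))"
    proof (rule even_card_involution[where f = "smooth D s"])
      fix x assume x: "x \<in> ?K - {d}"
      then have "x \<in> darts D" "x \<noteq> ?m" using K nm by auto
      moreover have "smooth D s x \<noteq> d"
        using calculation smooth_smooth by metis
      ultimately show "smooth D s x \<in> ?K - {d} \<and> smooth D s (smooth D s x) = x \<and> smooth D s x \<noteq> x"
        using x sm smooth_smooth smooth_neq by auto
    qed (use fin in simp)
    moreover have "d \<in> ?K" using self_in_circle by simp
    ultimately show False using fin by (metis card_Suc_Diff1 even_Suc)
  qed
  have "circle s d \<subseteq> ?K"
  proof (rule circle_least)
    show "d \<in> ?K" using self_in_circle by simp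
    show "smooth D s e \<in> ?K" if "e \<in> ?K" "e \<in> darts D" for e
      using sm[OF that(1)] \<open>?m \<in> ?K\<close> \<open>d \<in> ?K\<close> dd smooth_smooth by metis
  qed (use flip in blast)
  then show ?thesis by blast
qed

text \<open>Both old circles survive inside new ones by \<open>circle_subset_toggle\<close>, and
  these coincide because the new smoothing joins the old partner of \<open>d\<close> to
  \<open>opp d\<close>. Nothing else is reached, since all four darts of the crossing lie on the two
  old circles.\<close>

lemma circle_toggle_merge:
  assumes d: "d \<in> crossing_darts D" and ne: "circle s d \<noteq> circle s (opp d)" and e: "e \<in> darts D"
  shows "circle (toggle (orbit (rot D) d) s) e =
    (if e \<in> circle s d \<union> circle s (opp d) then circle s d \<union> circle s (opp d) else circle s e)"
proof -
  let ?v = "orbit (rot D) d" and ?s = "toggle (orbit (rot D) d) s"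
  let ?m = "smooth D s d" and ?A = "circle s d" and ?B = "circle s (opp d)"
  have dd: "d \<in> darts D" "opp d \<in> darts D" and oc: "opp d \<in> crossing_darts D"
    using d rot_in rot_crossing by (auto simp: crossing_darts_def)
  have vert: "?v = {d, ?m, opp d, smooth D s (opp d)}"
    using crossing_orbit[OF d] smooth_cases[OF dd(1), of s] smooth_opposite[OF d, of s]
    by (elim disjE conjE) (simp_all add: crossing_four[OF d] insert_commute)
  have "?v \<subseteq> ?A \<union> ?B"
    unfolding vert using circle_smooth[OF dd(1), of s] circle_smooth[OF dd(2), of s] self_in_circle
    by auto
  have closed: "smooth D ?s f \<in> ?A \<union> ?B" if "f \<in> ?A \<union> ?B" "f \<in> darts D" for f
  proof (cases "orbit (rot D) f = ?v")
    case True
    then have "smooth D ?s f \<in> ?v"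
      using vertex_smooth[OF that(2)] self_in_vertex[OF smooth_in[OF that(2)]] by metis
    then show ?thesis using \<open>?v \<subseteq> ?A \<union> ?B\<close> by blast
  next
    case False
    then show ?thesis
      using that smooth_in_circle_iff smooth_toggle_other by simp
  qed
  have "?A \<union> ?B \<subseteq> circle ?s d"
  proof -
    have A: "?A \<subseteq> circle ?s d"
      using ne circle_eq_iff by (intro circle_subset_toggle d) blast
    have "?B \<subseteq> circle (toggle (orbit (rot D) (opp d)) s) (opp d)"
      using ne circle_eq_iff crossing_four[OF d] by (intro circle_subset_toggle oc) metis
    then have B: "?B \<subseteq> circle ?s (opp d)" using dd by (simp add: vertex_rot rot_in)
    have mv: "orbit (rot D) ?m = ?v" "?m \<in> crossing_darts D" using vertex_smooth[OF dd(1)] smooth_cases[OF dd(1), of s] d rot_crossing by auto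
    have "?m \<in> ?A" using circle_smooth[OF dd(1)] self_in_circle by metis
    moreover have "smooth D ?s ?m = opp d"
      using smooth_toggle[OF mv(2), of s] mv smooth_smooth[OF dd(1)] by simp
    ultimately have "circle ?s (opp d) = circle ?s d"
      using A circle_smooth[of ?m ?s] smooth_in[OF dd(1)] circle_eqI by auto
    then show ?thesis using A B by simp
  qed
  moreover have "circle ?s f \<subseteq> ?A \<union> ?B" if "f \<in> ?A \<union> ?B" for f
    by (rule circle_least) (use that closed flip_in_circle_iff in auto)
  ultimately have in_union: "circle ?s f = ?A \<union> ?B" if "f \<in> ?A \<union> ?B" for f
    using that circle_eqI[of f ?s d] by blast
  show ?thesis
  proof (cases "e \<in> ?A \<union> ?B")
    case False
    have out: "f \<notin> ?A \<union> ?B" if f: "f \<in> circle ?s e" for f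
      using in_union[of f] circle_eqI[OF f] self_in_circle[of e ?s] False by blast
    have out': "f \<notin> ?A \<union> ?B" if f: "f \<in> circle s e" for f
    proof
      assume "f \<in> ?A \<union> ?B"
      then have "circle s e = ?A \<or> circle s e = ?B" using circle_eqI[OF f] circle_eqI by blast
      then show False using self_in_circle[of e s] False by blast
    qed
    have sm: "smooth D ?s f = smooth D s f" if "f \<notin> ?A \<union> ?B" "f \<in> darts D" for f
      using that \<open>?v \<subseteq> ?A \<union> ?B\<close> self_in_vertex smooth_toggle_other by blast
    have "circle ?s e \<subseteq> circle s e"
    proof (rule circle_least)
      show "smooth D ?s f \<in> circle s e" if "f \<in> circle s e" "f \<in> darts D" for f
        using sm[OF out'[OF that(1)] that(2)] that by (simp add: smooth_in_circle_iff)
    qed (simp_all add: self_in_circle flip_in_circle_iff)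
    moreover have "circle s e \<subseteq> circle ?s e"
    proof (rule circle_least)
      show "smooth D s f \<in> circle ?s e" if "f \<in> circle ?s e" "f \<in> darts D" for f
        using sm[OF out[OF that(1)] that(2), symmetric] that by (simp add: smooth_in_circle_iff)
    qed (simp_all add: self_in_circle flip_in_circle_iff)
    ultimately show ?thesis using False by simp
  qed (use in_union in simp)
qed

text \<open>A dart gets the colour of the region to its right. The set of all darts is closed under
  every smoothing, so every edge separates the colours.\<close>

lemma checkerboard:
  obtains col :: "'d \<Rightarrow> bool" where
    "\<And>d. d \<in> darts D \<Longrightarrow> col (flip D d) \<noteq> col d" "\<And>d. d \<in> darts D \<Longrightarrow> col (rot D d) \<noteq> col d"
proof -
  obtain R where "\<And>d. d \<in> darts D \<Longrightarrow> (region D d \<in> R) \<noteq> (region D (flip D d) \<in> R)"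
    using two_colouring[of "darts D" "{}"] flip_closed smooth_in by auto
  then show ?thesis using that[of "\<lambda>d. region D d \<in> R"] region_rot by simp
qed

lemma circle_toggle_split:
  assumes d: "d \<in> crossing_darts D" and eq: "circle s d = circle s (opp d)"
  shows "circle (toggle (orbit (rot D) d) s) d \<noteq> circle (toggle (orbit (rot D) d) s) (opp d)"
proof -
  \<comment> \<open>Going around the circles of a resolution permutes the darts of the colour of \<open>d\<close>.
     Toggling the crossing composes this permutation with the transposition of \<open>d\<close> and
     \<open>opp d\<close>.\<close>
  let ?v = "orbit (rot D) d" and ?s = "toggle (orbit (rot D) d) s"
  obtain col :: "'d \<Rightarrow> bool" where col: "\<And>d. d \<in> darts D \<Longrightarrow> col (flip D d) \<noteq> col d"
      "\<And>d. d \<in> darts D \<Longrightarrow> col (rot D d) \<noteq> col d"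
    using checkerboard by metis
  define S where "S = {e \<in> darts D. col e = col d}"
  define \<pi> where "\<pi> t e = smooth D t (flip D e)" for t e
  have dd: "d \<in> darts D" "opp d \<in> darts D" using d rot_in by (auto simp: crossing_darts_def)
  have cr: "rot D d \<in> darts D" "rot D (opp d) \<in> darts D" using dd rot_in by auto
  have S: "d \<in> S" "opp d \<in> S" using dd cr col(2) by (auto simp: S_def)
  have colsm: "col (smooth D t e) \<noteq> col e" if "e \<in> darts D" for e t
    using that smooth_cases[OF that, of t] col(2) rot_in by metis
  have \<pi>_in: "\<pi> t e \<in> S" if "e \<in> S" for t e
    using that col(1) colsm[of "flip D e" t] by (auto simp: S_def \<pi>_def smooth_in flip_closed)
  have \<pi>_inj: "inj_on (\<pi> t) S" for t
    using smooth_smooth flip_flip flip_closed unfolding \<pi>_def S_def inj_on_def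
    by (metis (mono_tags, lifting) mem_Collect_eq)
  \<comment> \<open>A circle alternates between the colours, and its darts of the other colour are
    the flips of those in \<open>S\<close>. So it is controlled by any subset of \<open>S\<close>
    that is invariant under \<open>\<pi> t\<close>.\<close>
  have sub: "circle t e \<subseteq> K \<union> flip D ` K" if K: "K \<subseteq> S" "\<pi> t ` K \<subseteq> K" "e \<in> K" for t K e
  proof (rule circle_least)
    have "finite K" using K finite_darts by (auto simp: S_def intro: finite_subset)
    then have onto: "\<pi> t ` K = K"
      using K inj_on_subset[OF \<pi>_inj[of t] K(1)] by (intro endo_inj_surj) auto
    have Kd: "K \<subseteq> darts D" using K by (auto simp: S_def)
    show "flip D f \<in> K \<union> flip D ` K" if "f \<in> K \<union> flip D ` K" for f
      using that Kd flip_flip by auto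
    show "smooth D t f \<in> K \<union> flip D ` K" if f: "f \<in> K \<union> flip D ` K" "f \<in> darts D" for f
    proof (cases "f \<in> K")
      case True
      then obtain g where "g \<in> K" "f = smooth D t (flip D g)" using onto by (auto simp: \<pi>_def)
      then show ?thesis using Kd flip_closed smooth_smooth by auto
    next
      case False
      then obtain g where "g \<in> K" "f = flip D g" using f by blast
      then show ?thesis using K by (auto simp: \<pi>_def)
    qed
  qed (use that in simp)
  have not_flip: "f \<notin> flip D ` K" if "f \<in> S" "K \<subseteq> S" for f K
    using that col(1) by (auto simp: S_def)
  have "orbit (\<pi> s) d \<subseteq> S" using \<pi>_in S by (intro orbit_subset_invariant) auto
  moreover have "d \<in> orbit (\<pi> s) d"
  proof (rule bij_betw_self_in_orbit[where A = S])
    have "finite S" using finite_darts by (simp add: S_def)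
    then show "finite S" "bij_betw (\<pi> s) S S"
      using \<pi>_inj \<pi>_in endo_inj_surj[of S "\<pi> s"] by (auto simp: bij_betw_def)
  qed (use S in simp)
  ultimately have "circle s d \<subseteq> orbit (\<pi> s) d \<union> flip D ` orbit (\<pi> s) d"
    by (intro sub) (auto intro: orbit.step)
  moreover have "opp d \<in> circle s d" using eq circle_eq_iff by blast
  ultimately have "opp d \<in> orbit (\<pi> s) d"
    using not_flip S \<open>orbit (\<pi> s) d \<subseteq> S\<close> by blast
  then have ex: "\<exists>n. (\<pi> s ^^ n) d = opp d" by (auto simp: orbit_altdef)
  define n where "n = (LEAST n. (\<pi> s ^^ n) d = opp d)"
  have n: "(\<pi> s ^^ n) d = opp d" using LeastI_ex[OF ex] by (simp add: n_def)
  have least: "(\<pi> s ^^ k) d \<noteq> opp d" if "k < n" for k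
    using that not_less_Least by (auto simp: n_def)
  have "n > 0" using n crossing_not_two[OF d] by (cases n) auto
  \<comment> \<open>The iterates before \<open>opp d\<close> is first reached. After toggling, the
    step that led to \<open>opp d\<close> leads back to \<open>d\<close>, so these iterates are
    closed up and \<open>opp d\<close> is cut off.\<close>
  define K where "K = (\<lambda>k. (\<pi> s ^^ k) d) ` {..<n}"
  have KO: "K \<subseteq> S"
  proof -
    have "(\<pi> s ^^ k) d \<in> S" for k using S \<pi>_in by (induction k) auto
    then show ?thesis by (auto simp: K_def)
  qed
  have "\<pi> ?s x \<in> K" if xK: "x \<in> K" for x
  proof -
    obtain k where k: "k < n" "x = (\<pi> s ^^ k) d" using xK by (auto simp: K_def)
    have x: "\<pi> s x = (\<pi> s ^^ Suc k) d" "x \<in> S" using k xK KO by auto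
    have fx: "flip D x \<in> darts D" using x flip_closed by (simp add: S_def)
    show ?thesis
    proof (cases "Suc k < n")
      case True
      have "\<pi> s x \<noteq> d"
      proof
        assume "\<pi> s x = d"
        then have "(\<pi> s ^^ Suc k) d = d" using x by simp
        moreover have "n = (n - Suc k) + Suc k" using True by simp
        ultimately have "(\<pi> s ^^ (n - Suc k)) d = opp d"
          using n by (metis funpow_add o_apply)
        then show False using least[of "n - Suc k"] True by simp
      qed
      moreover have "\<pi> s x \<noteq> opp d" using least[OF True] x by simp
      moreover have "\<pi> s x \<in> S" using \<pi>_in[OF x(2)] .
      moreover have "e = d \<or> e = opp d" if "e \<in> ?v" "e \<in> S" for e
        using that crossing_orbit[OF d] col(2)[OF dd(1)] col(2)[OF dd(2)] col(2)[OF cr(1)] by (auto simp: S_def)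
      ultimately have "\<pi> s x \<notin> ?v" by blast
      then have "orbit (rot D) (flip D x) \<noteq> ?v"
        using vertex_smooth[OF fx, of s] self_in_vertex[OF smooth_in[OF fx], of s] by (auto simp: \<pi>_def)
      then have "\<pi> ?s x = \<pi> s x" by (simp add: \<pi>_def smooth_toggle_other)
      then show ?thesis using True x(1) unfolding K_def by (metis image_eqI lessThan_iff)
    next
      case False
      then have "Suc k = n" using k by simp
      then have *: "smooth D s (flip D x) = opp d" using x n by (simp add: \<pi>_def)
      then have v: "orbit (rot D) (flip D x) = ?v"
        using vertex_smooth[OF fx, of s] dd by (simp add: vertex_rot cr)
      have "flip D x = smooth D s (opp d)" using * smooth_smooth[OF fx] by metis
      then have "flip D x \<in> crossing_darts D"
        using smooth_cases[OF dd(2), of s] rot_crossing d by auto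
      then have "\<pi> ?s x = d" using smooth_toggle[of "flip D x" s] v * crossing_four[OF d] by (simp add: \<pi>_def)
      then show ?thesis using \<open>n > 0\<close> unfolding K_def by (metis funpow_0 image_eqI lessThan_iff)
    qed
  qed
  moreover have "d \<in> K" using \<open>n > 0\<close> unfolding K_def by (metis funpow_0 image_eqI lessThan_iff)
  ultimately have "circle ?s d \<subseteq> K \<union> flip D ` K" using KO by (intro sub) auto
  moreover have "opp d \<notin> K"
  proof
    assume "opp d \<in> K"
    then obtain k where "k < n" "opp d = (\<pi> s ^^ k) d" unfolding K_def by blast
    then show False using least[of k] by simp
  qed
  ultimately have "opp d \<notin> circle ?s d" using not_flip[OF S(2) KO] by blast
  then show ?thesis using self_in_circle by metis
qed

end

section \<open>Linear operators on coefficient functions, and the labels before a saddle\<close>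

definition scale :: "'k::field \<Rightarrow> ('g \<Rightarrow> 'k) \<Rightarrow> 'g \<Rightarrow> 'k" where
  "scale a f = (\<lambda>g. a * f g)"

definition linear_op :: "(('g \<Rightarrow> 'k::field) \<Rightarrow> ('g \<Rightarrow> 'k)) \<Rightarrow> bool" where
  "linear_op T \<longleftrightarrow> (\<forall>f g. T (f + g) = T f + T g) \<and> (\<forall>a f. T (scale a f) = scale a (T f))"

definition basis_chain :: "'g \<Rightarrow> 'g \<Rightarrow> 'k::field" where
  "basis_chain g = (\<lambda>h. if h = g then 1 else 0)"

lemma linear_opI:
  "(\<And>f g. T (f + g) = T f + T g) \<Longrightarrow> (\<And>a f. T (scale a f) = scale a (T f)) \<Longrightarrow> linear_op T"
  by (simp add: linear_op_def)

lemma linear_op_add: "linear_op T \<Longrightarrow> T (f + g) = T f + T g"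
  and linear_op_scale: "linear_op T \<Longrightarrow> T (scale a f) = scale a (T f)"
  by (simp_all add: linear_op_def)

lemma scale_simps [simp]: "scale 0 f = 0" "scale a 0 = 0" "scale 1 f = f"
  and scale_add: "scale a (f + g) = scale a f + scale a g"
  and add_scale: "scale (a + b) f = scale a f + scale b f"
  and scale_scale: "scale a (scale b f) = scale (a * b) f"
  by (auto simp: scale_def fun_eq_iff distrib_left distrib_right)

lemma linear_op_zero: "linear_op T \<Longrightarrow> T 0 = 0"
  using linear_op_scale[of T 0 0] by simp

lemma linear_op_sum:
  assumes "linear_op T"
  shows "T (\<Sum>i\<in>I. F i) = (\<Sum>i\<in>I. T (F i))"
proof (induction I rule: infinite_finite_induct)
  case (insert i I)
  then show ?case by (simp only: sum.insert linear_op_add[OF assms] not_False_eq_True)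
qed (simp_all only: sum.infinite sum.empty linear_op_zero[OF assms] not_False_eq_True)

lemma sum_fun_apply: "(\<Sum>i\<in>I. F i) x = (\<Sum>i\<in>I. F i x)"
  by (induction I rule: infinite_finite_induct) simp_all

lemma scale_sum: "scale a (\<Sum>i\<in>I. F i) = (\<Sum>i\<in>I. scale a (F i))"
  by (simp add: scale_def fun_eq_iff sum_fun_apply sum_distrib_left)

lemma linear_op_comp: "linear_op T \<Longrightarrow> linear_op U \<Longrightarrow> linear_op (\<lambda>f. T (U f))"
  by (simp add: linear_op_def)

lemma linear_op_plus: "linear_op T \<Longrightarrow> linear_op U \<Longrightarrow> linear_op (\<lambda>f. T f + U f)"
  by (simp add: linear_op_def scale_add ac_simps)

text \<open>Circles \<open>A\<close> and \<open>B\<close> merge into \<open>C\<close>, the circles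
  in \<open>R\<close> stay, and \<open>P\<close> says that a circle avoids the basepoint. A label x
  on \<open>C\<close> comes from x on exactly one of \<open>A\<close> and \<open>B\<close>, a label
  1 only from 1 on both.\<close>

lemma merge_label_sets:
  assumes R: "A \<notin> R" "B \<notin> R" "C \<notin> R" "C \<noteq> A" "C \<noteq> B" "A \<noteq> B"
    and Y: "Y \<subseteq> insert C R" "\<And>c. c \<in> Y \<Longrightarrow> P c" "P C \<Longrightarrow> P A \<and> P B"
  shows "{X. (X \<subseteq> insert A (insert B R) \<and> (\<forall>c\<in>X. P c)) \<and>
      X \<inter> R = Y \<inter> R \<and> merge_coeff (A \<in> X) (B \<in> X) (C \<in> Y)} =
    (if C \<in> Y then {insert A (Y - {C}), insert B (Y - {C})} else {Y})" (is "?L = _")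
proof (cases "C \<in> Y")
  case True
  have YR: "Y - {C} = Y \<inter> R" using R(3) Y(1) by blast
  have "?L = {insert A (Y \<inter> R), insert B (Y \<inter> R)}"
  proof (intro equalityI subsetI)
    fix X assume "X \<in> ?L"
    then have "X = insert A (Y \<inter> R) \<or> X = insert B (Y \<inter> R)"
      using True unfolding merge_coeff_def by blast
    then show "X \<in> {insert A (Y \<inter> R), insert B (Y \<inter> R)}" by simp
  next
    fix X assume "X \<in> {insert A (Y \<inter> R), insert B (Y \<inter> R)}"
    then consider "X = insert A (Y \<inter> R)" | "X = insert B (Y \<inter> R)" by blast
    then show "X \<in> ?L"
      by cases (use True Y(2,3) R(1,2,6) in \<open>simp_all add: merge_coeff_def Int_assoc subset_insertI2\<close>)
  qed
  then show ?thesis using True unfolding YR by simp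
next
  case False
  then have YR: "Y \<inter> R = Y" using Y(1) by blast
  have "?L = {Y}"
  proof (intro equalityI subsetI)
    fix X assume "X \<in> ?L"
    then have "X = Y \<inter> R" using False unfolding merge_coeff_def by blast
    then show "X \<in> {Y}" using YR by simp
  next
    fix X assume "X \<in> {Y}"
    then show "X \<in> ?L" using False Y(2) R(1,2) YR unfolding merge_coeff_def by blast
  qed
  then show ?thesis using False by simp
qed

text \<open>Circle \<open>A\<close> splits into \<open>B\<close> and \<open>C\<close>: two labels x
  come from x, one label x comes from 1, and no label x comes from nothing. The last assumption
  reflects that a circle through the basepoint has a part through the basepoint.\<close>

lemma split_label_sets:
  assumes R: "B \<notin> R" "C \<notin> R" "A \<notin> R" "A \<noteq> B" "A \<noteq> C" "B \<noteq> C"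
    and Y: "Y \<subseteq> insert B (insert C R)" "\<And>c. c \<in> Y \<Longrightarrow> P c" "P B \<Longrightarrow> P C \<Longrightarrow> P A"
  shows "{X. (X \<subseteq> insert A R \<and> (\<forall>c\<in>X. P c)) \<and>
      X \<inter> R = Y \<inter> R \<and> split_coeff (A \<in> X) (B \<in> Y) (C \<in> Y)} =
    (if B \<in> Y \<and> C \<in> Y then {insert A (Y - {B, C})}
     else if B \<in> Y \<or> C \<in> Y then {Y - {B, C}} else {})" (is "?L = _")
proof -
  have YR: "Y - {B, C} = Y \<inter> R" using R(1,2) Y(1) by blast
  show ?thesis
  proof (cases "B \<in> Y \<and> C \<in> Y")
    case True
    have "?L = {insert A (Y \<inter> R)}"
    proof (intro equalityI subsetI)
      fix X assume "X \<in> ?L"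
      then have "X = insert A (Y \<inter> R)" using True unfolding split_coeff_def by (simp split: if_splits) blast
      then show "X \<in> {insert A (Y \<inter> R)}" by simp
    next
      fix X assume "X \<in> {insert A (Y \<inter> R)}"
      then show "X \<in> ?L"
        using True Y(2,3) R(3) by (simp add: split_coeff_def Int_assoc subset_insertI2)
    qed
    then show ?thesis unfolding YR using True by simp
  next
    case False
    have "?L = (if B \<in> Y \<or> C \<in> Y then {Y \<inter> R} else {})"
    proof (intro equalityI subsetI)
      fix X assume X: "X \<in> ?L"
      then have "A \<notin> X" "B \<in> Y \<or> C \<in> Y" using False unfolding split_coeff_def by (auto split: if_splits)
      moreover from this X have "X = Y \<inter> R" by blast
      ultimately show "X \<in> (if B \<in> Y \<or> C \<in> Y then {Y \<inter> R} else {})" by simp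
    next
      fix X assume "X \<in> (if B \<in> Y \<or> C \<in> Y then {Y \<inter> R} else {})"
      then have "X = Y \<inter> R" "B \<in> Y \<or> C \<in> Y" by (auto split: if_splits)
      then show "X \<in> ?L" using False Y(2) R(3) by (auto simp: split_coeff_def Int_assoc)
    qed
    moreover have "\<not> (B \<in> Y \<and> C \<in> Y)" using False .
    ultimately show ?thesis unfolding YR by presburger
  qed
qed

context knot_diagram
begin

section \<open>Multiplication operators and saddle maps\<close>

definition supported :: "('d, 'k::field) chain set" where
  "supported = {f. \<forall>g. g \<notin> generators D \<longrightarrow> f g = 0}"

text \<open>A circle exists only in some resolutions, but a dart lies on a circle of each; so darts
  index operators on the whole complex. The coefficient at \<open>X\<close> is read off at
  \<open>X\<close> without the circle, and \<open>generators\<close> forces 0 on the circle through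
  the basepoint.\<close>

definition dart_mult :: "'d \<Rightarrow> ('d, 'k::field) chain \<Rightarrow> ('d, 'k) chain" where
  "dart_mult d f = (\<lambda>(s, X). if (s, X) \<in> generators D \<and> circle s d \<in> X
     then f (s, X - {circle s d}) else 0)"

text \<open>The matrix entries of \<open>khovanov_edge\<close> without the demand that a crossing be
  added, so that the same formula can be read from \<open>s'\<close> to \<open>s\<close>.\<close>

definition local_edge :: "'d set set \<Rightarrow> 'd set set \<Rightarrow> 'd set set \<Rightarrow> 'd set set \<Rightarrow> bool" where
  "local_edge s s' X X' \<longleftrightarrow>
     X \<inter> (circles D s \<inter> circles D s') = X' \<inter> (circles D s \<inter> circles D s') \<and>
     ((\<exists>a b c. a \<noteq> b \<and> circles D s - circles D s' = {a, b} \<and> circles D s' - circles D s = {c} \<and>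
         merge_coeff (a \<in> X) (b \<in> X) (c \<in> X')) \<or>
      (\<exists>a b c. b \<noteq> c \<and> circles D s - circles D s' = {a} \<and> circles D s' - circles D s = {b, c} \<and>
         split_coeff (a \<in> X) (b \<in> X') (c \<in> X')))"

text \<open>
  The differential only uses the part of \<open>saddle v\<close> that adds \<open>v\<close> to the resolution; the
  other part is the same cobordism map read backwards.
\<close>

definition saddle :: "'d set \<Rightarrow> ('d, 'k::field) chain \<Rightarrow> ('d, 'k) chain" where
  "saddle v f = (\<lambda>(s', X'). if (s', X') \<in> generators D
     then (\<Sum>X | X \<subseteq> free_circles D (toggle v s') \<and> local_edge (toggle v s') s' X X'. f (toggle v s', X))
     else 0)"

lemma finite_crossings: "finite (crossings D)"
  using finite_darts by (simp add: crossings_def crossing_darts_def)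

lemma finite_free_circles: "finite (free_circles D s)"
  using finite_circles by (simp add: free_circles_def)

lemma finite_generators: "finite (generators D)"
proof -
  have "generators D = (SIGMA s:Pow (crossings D). Pow (free_circles D s))"
    by (auto simp: generators_def)
  then show ?thesis using finite_crossings finite_free_circles by simp
qed

lemma generators_iff:
  "(s, X) \<in> generators D \<longleftrightarrow> s \<subseteq> crossings D \<and> X \<subseteq> circles D s \<and> (\<forall>c\<in>X. basedart D \<notin> c)"
  by (auto simp: generators_def free_circles_def)

lemma generatorsD:
  assumes "(s, X) \<in> generators D"
  shows "s \<subseteq> crossings D" "X \<subseteq> circles D s" "\<And>c. c \<in> X \<Longrightarrow> basedart D \<notin> c"
  using assms by (auto simp: generators_iff)

lemma toggle_crossings: "v \<in> crossings D \<Longrightarrow> toggle v s \<subseteq> crossings D \<longleftrightarrow> s \<subseteq> crossings D"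
  by (auto simp: toggle_def)

lemma crossing_in: "d \<in> crossing_darts D \<Longrightarrow> orbit (rot D) d \<in> crossings D"
  by (simp add: crossings_def)

text \<open>\<open>circle_toggle_merge\<close> in terms of sets of circles, with \<open>R\<close>
  for the circles not involved. Applied to the toggled resolution it describes a split.\<close>

lemma circles_toggle:
  assumes d: "d \<in> crossing_darts D" and ne: "circle s d \<noteq> circle s (opp d)"
  defines "A \<equiv> circle s d" and "B \<equiv> circle s (opp d)" and "t \<equiv> toggle (orbit (rot D) d) s"
  obtains R where "circles D s = insert A (insert B R)" "circles D t = insert (A \<union> B) R"
    "A \<notin> R" "B \<notin> R" "A \<union> B \<notin> R" "A \<union> B \<noteq> A" "A \<union> B \<noteq> B" "A \<noteq> B"
    "circle t d = A \<union> B" "circle t (opp d) = A \<union> B"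
proof
  let ?R = "circles D s - {A, B}"
  have dd: "d \<in> darts D" "opp d \<in> darts D" using d rot_in by (auto simp: crossing_darts_def)
  then have AB: "A \<in> circles D s" "B \<in> circles D s" by (auto simp: circles_eq A_def B_def)
  have disj: "C = E" if "x \<in> C" "x \<in> E" "C \<in> circles D s" "E \<in> circles D s" for x C E
    using that circle_closed(4) by metis
  have in_AB: "d \<in> A" "opp d \<in> B" using self_in_circle by (auto simp: A_def B_def)
  show "A \<noteq> B" using ne by (simp add: A_def B_def)
  then have "A \<inter> B = {}" using disj AB by blast
  then show un: "A \<union> B \<noteq> A" "A \<union> B \<noteq> B" using in_AB by auto
  show "circles D s = insert A (insert B ?R)" using AB by auto
  show "A \<notin> ?R" "B \<notin> ?R" by auto
  show "A \<union> B \<notin> ?R" using disj[of d "A \<union> B" A] AB in_AB un by blast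
  have t: "circle t e = (if e \<in> A \<union> B then A \<union> B else circle s e)" if "e \<in> darts D" for e
    using circle_toggle_merge[OF d ne that] by (simp add: A_def B_def t_def)
  show "circle t d = A \<union> B" "circle t (opp d) = A \<union> B" using t dd in_AB by auto
  have ABd: "A \<subseteq> darts D" "B \<subseteq> darts D" using circle_subset dd by (auto simp: A_def B_def)
  have "circles D t = insert (A \<union> B) {circle s e | e. e \<in> darts D \<and> e \<notin> A \<union> B}"
    unfolding circles_eq using t dd in_AB by (auto simp: image_iff)
  also have "{circle s e | e. e \<in> darts D \<and> e \<notin> A \<union> B} = ?R"
  proof (intro Set.set_eqI iffI)
    fix C assume "C \<in> {circle s e | e. e \<in> darts D \<and> e \<notin> A \<union> B}"
    then show "C \<in> ?R" using self_in_circle by (auto simp: circles_eq)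
  next
    fix C assume C: "C \<in> ?R"
    then obtain e where e: "e \<in> darts D" "C = circle s e" by (auto simp: circles_eq)
    then have "e \<in> C" using self_in_circle by simp
    then have "e \<notin> A \<union> B" using C disj[of e C] AB by blast
    then show "C \<in> {circle s e | e. e \<in> darts D \<and> e \<notin> A \<union> B}" using e by blast
  qed
  finally show "circles D t = insert (A \<union> B) ?R" .
qed

lemma dart_mult_supported: "dart_mult d f \<in> supported"
  by (auto simp: supported_def dart_mult_def)

lemma saddle_supported: "saddle v f \<in> supported"
  by (auto simp: supported_def saddle_def)

lemma linear_dart_mult: "linear_op (dart_mult d)"
  by (rule linear_opI) (auto simp: dart_mult_def scale_def fun_eq_iff)

lemma linear_saddle: "linear_op (saddle v)"
  by (rule linear_opI) (auto simp: saddle_def scale_def fun_eq_iff sum.distrib sum_distrib_left)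

lemma saddle_merge:
  assumes d: "d \<in> crossing_darts D" and g: "(t, X') \<in> generators D"
    and s: "s = toggle (orbit (rot D) d) t" and ne: "circle s d \<noteq> circle s (opp d)"
  shows "saddle (orbit (rot D) d) f (t, X') =
    (if circle t d \<in> X' then f (s, insert (circle s d) (X' - {circle t d})) +
       f (s, insert (circle s (opp d)) (X' - {circle t d})) else f (s, X'))"
proof -
  let ?A = "circle s d" and ?B = "circle s (opp d)" and ?C = "circle t d"
  obtain R where R: "circles D s = insert ?A (insert ?B R)" "circles D t = insert ?C R"
    "?A \<notin> R" "?B \<notin> R" "?C \<notin> R" "?C \<noteq> ?A" "?C \<noteq> ?B" "?A \<noteq> ?B" "?C = ?A \<union> ?B"
    using circles_toggle[OF d ne] unfolding s toggle_toggle by metis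
  note X' = generatorsD(2,3)[OF g, unfolded R(2)]
  have sub: "X \<subseteq> free_circles D s \<longleftrightarrow> X \<subseteq> insert ?A (insert ?B R) \<and> (\<forall>c\<in>X. basedart D \<notin> c)" for X
    unfolding free_circles_def R(1) by auto
  have int: "circles D s \<inter> circles D t = R" "circles D s - circles D t = {?A, ?B}"
    "circles D t - circles D s = {?C}"
    unfolding R(1,2) using R(3-8) by auto
  have le: "local_edge s t X X' \<longleftrightarrow> X \<inter> R = X' \<inter> R \<and> merge_coeff (?A \<in> X) (?B \<in> X) (?C \<in> X')" for X
    unfolding local_edge_def int using R(8) by (auto simp: doubleton_eq_iff merge_coeff_def)
  have "{X. X \<subseteq> free_circles D s \<and> local_edge s t X X'} =
    (if ?C \<in> X' then {insert ?A (X' - {?C}), insert ?B (X' - {?C})} else {X'})"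
    unfolding sub le
    by (rule merge_label_sets[OF R(3-8) X']) (use R(9) in auto)
  moreover have "insert ?A (X' - {?C}) \<noteq> insert ?B (X' - {?C})"
    using R(3-8) X'(1) by auto
  ultimately show ?thesis using g by (simp add: saddle_def s[symmetric])
qed

lemma saddle_split:
  assumes d: "d \<in> crossing_darts D" and g: "(t, X') \<in> generators D"
    and s: "s = toggle (orbit (rot D) d) t" and ne: "circle t d \<noteq> circle t (opp d)"
  shows "saddle (orbit (rot D) d) f (t, X') =
    (if circle t d \<in> X' \<and> circle t (opp d) \<in> X'
       then f (s, insert (circle s d) (X' - {circle t d, circle t (opp d)}))
     else if circle t d \<in> X' \<or> circle t (opp d) \<in> X' then f (s, X' - {circle t d, circle t (opp d)})
     else 0)"
proof -
  let ?A = "circle s d" and ?B = "circle t d" and ?C = "circle t (opp d)"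
  obtain R where R: "circles D t = insert ?B (insert ?C R)" "circles D s = insert ?A R"
    "?B \<notin> R" "?C \<notin> R" "?A \<notin> R" "?A \<noteq> ?B" "?A \<noteq> ?C" "?B \<noteq> ?C" "?A = ?B \<union> ?C"
    using circles_toggle[OF d ne] unfolding s by metis
  note X' = generatorsD(2,3)[OF g, unfolded R(1)]
  have sub: "X \<subseteq> free_circles D s \<longleftrightarrow> X \<subseteq> insert ?A R \<and> (\<forall>c\<in>X. basedart D \<notin> c)" for X
    unfolding free_circles_def R(2) by auto
  have int: "circles D s \<inter> circles D t = R" "circles D s - circles D t = {?A}"
    "circles D t - circles D s = {?B, ?C}"
    unfolding R(1,2) using R(3-8) by auto
  have le: "local_edge s t X X' \<longleftrightarrow> X \<inter> R = X' \<inter> R \<and> split_coeff (?A \<in> X) (?B \<in> X') (?C \<in> X')" for X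
    unfolding local_edge_def int using R(8) by (auto simp: doubleton_eq_iff split_coeff_def)
  have "{X. X \<subseteq> free_circles D s \<and> local_edge s t X X'} =
    (if ?B \<in> X' \<and> ?C \<in> X' then {insert ?A (X' - {?B, ?C})}
     else if ?B \<in> X' \<or> ?C \<in> X' then {X' - {?B, ?C}} else {})"
    unfolding sub le
    by (rule split_label_sets[OF R(3-8) X']) (use R(9) in auto)
  then show ?thesis using g by (simp add: saddle_def s[symmetric])
qed

text \<open>Multiplication and comultiplication of \<open>A\<close> are module maps, and
  \<open>e\<close> marks corresponding tensor factors before and after the saddle. The cases are
  that \<open>e\<close> lies on the first circle, on the second circle, or away from the
  saddle.\<close>

lemma saddle_dart_mult:
  assumes d: "d \<in> crossing_darts D" and e: "e \<in> darts D" and f: "f \<in> supported"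
  shows "saddle (orbit (rot D) d) (dart_mult e f) = dart_mult e (saddle (orbit (rot D) d) f)"
proof (rule ext, clarify)
  fix t X'
  let ?v = "orbit (rot D) d"
  define s where "s = toggle ?v t"
  have ts: "t = toggle ?v s" by (simp add: s_def)
  have cs: "s \<subseteq> crossings D \<longleftrightarrow> t \<subseteq> crossings D"
    using toggle_crossings[OF crossing_in[OF d]] by (simp add: s_def)
  have z: "f (s, X) = 0" if "\<not> X \<subseteq> free_circles D s" for X
    using f that by (auto simp: supported_def generators_def)
  have gen': "(t, X' - {c}) \<in> generators D" if "(t, X') \<in> generators D" for c
    using that by (auto simp: generators_def)
  show "saddle ?v (dart_mult e f) (t, X') = dart_mult e (saddle ?v f) (t, X')"
  proof (cases "(t, X') \<in> generators D")
    case False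
    then show ?thesis by (simp add: saddle_def dart_mult_def)
  next
    case g: True
    show ?thesis
    proof (cases "circle s d = circle s (opp d)")
      case False
      let ?A = "circle s d" and ?B = "circle s (opp d)" and ?C = "circle t d"
      obtain R where R: "circles D s = insert ?A (insert ?B R)" "circles D t = insert ?C R"
        "?A \<notin> R" "?B \<notin> R" "?C \<notin> R" "?C \<noteq> ?A" "?C \<noteq> ?B" "?A \<noteq> ?B" "?C = ?A \<union> ?B"
        using circles_toggle[OF d False] unfolding ts[symmetric] by metis
      note X' = generatorsD(2,3,1)[OF g, unfolded R(2)]
      have gens: "(s, X) \<in> generators D \<longleftrightarrow> X \<subseteq> insert ?A (insert ?B R) \<and> (\<forall>c\<in>X. basedart D \<notin> c)" for X
        using X'(3) cs by (simp add: generators_iff R(1))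
      have ce: "circle t e = (if e \<in> ?C then ?C else circle s e)" "e \<in> circle s e" "e \<in> circle t e"
        using circle_toggle_merge[OF d False e] R(9) by (simp_all add: ts self_in_circle)
      consider "circle s e = ?A" "circle t e = ?C" | "circle s e = ?B" "circle t e = ?C"
        | "circle s e \<in> R" "circle t e = circle s e"
      proof -
        have "circle s e \<in> circles D s" using e by (simp add: circles_eq)
        then have "circle s e \<in> R" if "e \<notin> ?C"
          using that R(9) ce(2) unfolding R(1) by blast
        moreover have "circle s e = ?A \<or> circle s e = ?B" if "e \<in> ?C"
          using that R(9) circle_eqI by auto
        ultimately show ?thesis using that ce(1) by presburger
      qed
      then show ?thesis
      proof cases
        case 1
        have AX: "?A \<notin> X'" "?A \<notin> insert ?B (X' - {?C})" "insert ?A (X' - {?C}) - {?A} = X' - {?C}"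
          using X'(1) R(3-8) by auto
        have "(s, insert ?A (X' - {?C})) \<in> generators D" if "?C \<in> X'"
          using X'(1) X'(2)[OF that] X'(2) R(9) unfolding gens by auto
        then show ?thesis
          unfolding saddle_merge[OF d g s_def False] dart_mult_def
          using 1 g gen' saddle_merge[OF d gen'[OF g] s_def False, of f ?C] AX by simp
      next
        case 2
        have AX: "?B \<notin> X'" "?B \<notin> insert ?A (X' - {?C})" "insert ?B (X' - {?C}) - {?B} = X' - {?C}"
          using X'(1) R(3-8) by auto
        have "(s, insert ?B (X' - {?C})) \<in> generators D" if "?C \<in> X'"
          using X'(1) X'(2)[OF that] X'(2) R(9) unfolding gens by auto
        then show ?thesis
          unfolding saddle_merge[OF d g s_def False] dart_mult_def
          using 2 g gen' saddle_merge[OF d gen'[OF g] s_def False, of f ?C] AX by simp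
      next
        case 3
        let ?E = "circle s e"
        have E: "?E \<noteq> ?A" "?E \<noteq> ?B" "?E \<noteq> ?C" using 3(1) R(3-5) by metis+
        have "(s, insert ?A (X' - {?C})) \<in> generators D" "(s, insert ?B (X' - {?C})) \<in> generators D" if "?C \<in> X'"
          using X'(1) X'(2)[OF that] X'(2) R(9) unfolding gens by auto
        moreover have "(s, X') \<in> generators D" if "?C \<notin> X'"
          using X'(1,2) that unfolding gens by auto
        moreover have "insert F (X' - {?C}) - {?E} = insert F (X' - {?E} - {?C})" if "F \<noteq> ?E" for F
          using that by auto
        ultimately show ?thesis
          unfolding saddle_merge[OF d g s_def False] dart_mult_def
          using 3 g gen' saddle_merge[OF d gen'[OF g] s_def False, of f ?E] E by simp
      qed
    next
      case True
      then have ne: "circle t d \<noteq> circle t (opp d)"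
        using circle_toggle_split[OF d True] by (simp add: ts)
      let ?A = "circle s d" and ?B = "circle t d" and ?C = "circle t (opp d)"
      obtain R where R: "circles D t = insert ?B (insert ?C R)" "circles D s = insert ?A R"
        "?B \<notin> R" "?C \<notin> R" "?A \<notin> R" "?A \<noteq> ?B" "?A \<noteq> ?C" "?B \<noteq> ?C" "?A = ?B \<union> ?C"
        using circles_toggle[OF d ne] unfolding s_def by metis
      note X' = generatorsD(2,3,1)[OF g, unfolded R(1)]
      have gens: "(s, X) \<in> generators D \<longleftrightarrow> X \<subseteq> insert ?A R \<and> (\<forall>c\<in>X. basedart D \<notin> c)" for X
        using X'(3) cs by (simp add: generators_iff R(2))
      have ce: "circle s e = (if e \<in> ?A then ?A else circle t e)" "e \<in> circle s e" "e \<in> circle t e"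
        using circle_toggle_merge[OF d ne e] R(9) by (simp_all add: s_def self_in_circle)
      consider "circle s e = ?A" "circle t e = ?B" | "circle s e = ?A" "circle t e = ?C"
        | "circle s e \<in> R" "circle t e = circle s e"
      proof -
        have "circle t e \<in> circles D t" using e by (simp add: circles_eq)
        then have "circle t e \<in> R" if "e \<notin> ?A"
          using that R(9) ce(3) unfolding R(1) by blast
        moreover have "circle t e = ?B \<or> circle t e = ?C" if "e \<in> ?A"
          using that R(9) circle_eqI by auto
        ultimately show ?thesis using that ce(1) by presburger
      qed
      then show ?thesis
      proof cases
        case 1
        have AX: "?A \<notin> X'" "insert ?A (X' - {?B, ?C}) - {?A} = X' - {?B, ?C}" "X' - {?B} - {?B, ?C} = X' - {?B, ?C}"
          using X'(1) R(3-8) by auto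
        have "(s, insert ?A (X' - {?B, ?C})) \<in> generators D" if "?B \<in> X'" "?C \<in> X'"
          using X'(1) X'(2)[OF that(1)] X'(2)[OF that(2)] X'(2) R(9) unfolding gens by auto
        then show ?thesis
          unfolding saddle_split[OF d g s_def ne] dart_mult_def
          using 1 g gen' saddle_split[OF d gen'[OF g] s_def ne, of f ?B] AX R(8) by simp
      next
        case 2
        have AX: "?A \<notin> X'" "insert ?A (X' - {?B, ?C}) - {?A} = X' - {?B, ?C}" "X' - {?C} - {?B, ?C} = X' - {?B, ?C}"
          using X'(1) R(3-8) by auto
        have "(s, insert ?A (X' - {?B, ?C})) \<in> generators D" if "?B \<in> X'" "?C \<in> X'"
          using X'(1) X'(2)[OF that(1)] X'(2)[OF that(2)] X'(2) R(9) unfolding gens by auto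
        then show ?thesis
          unfolding saddle_split[OF d g s_def ne] dart_mult_def
          using 2 g gen' saddle_split[OF d gen'[OF g] s_def ne, of f ?C] AX R(8) by simp
      next
        case 3
        let ?E = "circle s e"
        have E: "?E \<noteq> ?A" "?E \<noteq> ?B" "?E \<noteq> ?C" using 3(1) R(3-5) by metis+
        have "(s, insert ?A (X' - {?B, ?C})) \<in> generators D" if "?B \<in> X'" "?C \<in> X'"
          using X'(1) X'(2)[OF that(1)] X'(2)[OF that(2)] X'(2) R(9) unfolding gens by auto
        moreover have "(s, X' - {?B, ?C}) \<in> generators D"
          using X'(1,2) unfolding gens by auto
        moreover have "insert ?A (X' - {?B, ?C}) - {?E} = insert ?A (X' - {?E} - {?B, ?C})"
          "X' - {?B, ?C} - {?E} = X' - {?E} - {?B, ?C}"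
          using E by auto
        ultimately show ?thesis
          unfolding saddle_split[OF d g s_def ne] dart_mult_def
          using 3 g gen' saddle_split[OF d gen'[OF g] s_def ne, of f ?E] E by simp
      qed
    qed
  qed
qed

section \<open>Operators commuting with multiplication\<close>

lemma supported_basis: "g \<in> generators D \<Longrightarrow> basis_chain g \<in> supported"
  by (auto simp: supported_def basis_chain_def)

lemma supported_add: "f \<in> supported \<Longrightarrow> g \<in> supported \<Longrightarrow> f + g \<in> supported"
  and supported_scale: "f \<in> supported \<Longrightarrow> scale a f \<in> supported"
  and supported_zero: "0 \<in> supported"
  by (auto simp: supported_def scale_def)

lemma supported_sum: "(\<And>i. i \<in> I \<Longrightarrow> F i \<in> supported) \<Longrightarrow> (\<Sum>i\<in>I. F i) \<in> supported"
  by (auto simp: supported_def sum_fun_apply)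

lemma supported_expand:
  assumes "f \<in> supported"
  shows "f = (\<Sum>g\<in>generators D. scale (f g) (basis_chain g))"
proof
  fix h
  have "(\<Sum>g\<in>generators D. scale (f g) (basis_chain g)) h = (\<Sum>g\<in>generators D. if h = g then f g else 0)"
    unfolding sum_fun_apply by (rule sum.cong) (auto simp: scale_def basis_chain_def)
  also have "\<dots> = (if h \<in> generators D then f h else 0)"
    using finite_generators by simp
  also have "\<dots> = f h" using assms unfolding supported_def by (cases h) simp
  finally show "f h = (\<Sum>g\<in>generators D. scale (f g) (basis_chain g)) h" ..
qed

text \<open>Endomorphisms of the supported chains as a module over the algebra generated by the
  multiplications with x.\<close>

definition mult_linear :: "(('d, 'k::field) chain \<Rightarrow> ('d, 'k) chain) \<Rightarrow> bool" where
  "mult_linear T \<longleftrightarrow> linear_op T \<and> (\<forall>f\<in>supported. T f \<in> supported) \<and>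
     (\<forall>e\<in>darts D. \<forall>f\<in>supported. T (dart_mult e f) = dart_mult e (T f))"

lemma mult_linearD:
  assumes "mult_linear T"
  shows "linear_op T" "f \<in> supported \<Longrightarrow> T f \<in> supported"
    "e \<in> darts D \<Longrightarrow> f \<in> supported \<Longrightarrow> T (dart_mult e f) = dart_mult e (T f)"
  using assms by (auto simp: mult_linear_def)

lemma mult_linear_comp: "mult_linear T \<Longrightarrow> mult_linear U \<Longrightarrow> mult_linear (\<lambda>f. T (U f))"
  by (simp add: mult_linear_def linear_op_comp)

lemma mult_linear_add: "mult_linear T \<Longrightarrow> mult_linear U \<Longrightarrow> mult_linear (\<lambda>f. T f + U f)"
  by (simp add: mult_linear_def linear_op_plus supported_add linear_op_add[OF linear_dart_mult])

lemma mult_linear_zero: "mult_linear (\<lambda>f. 0)"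
  by (simp add: mult_linear_def linear_op_def supported_zero linear_op_zero[OF linear_dart_mult])

lemma mult_linear_dart_mult: "mult_linear (dart_mult d :: ('d, 'k::field) chain \<Rightarrow> ('d, 'k) chain)"
proof -
  have "dart_mult d (dart_mult e f) = dart_mult e (dart_mult d f)" for e and f :: "('d, 'k) chain"
  proof (rule ext, clarify)
    fix s X
    have "(s, X - {c}) \<in> generators D" if "(s, X) \<in> generators D" for c
      using that by (auto simp: generators_iff)
    then show "dart_mult d (dart_mult e f) (s, X) = dart_mult e (dart_mult d f) (s, X)"
      by (cases "circle s d = circle s e") (simp_all add: dart_mult_def Diff_insert2[symmetric] insert_commute)
  qed
  then show ?thesis
    by (simp add: mult_linear_def linear_dart_mult dart_mult_supported)
qed

lemma mult_linear_saddle: "d \<in> crossing_darts D \<Longrightarrow> mult_linear (saddle (orbit (rot D) d))"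
  by (simp add: mult_linear_def linear_saddle saddle_supported saddle_dart_mult)

abbreviation unit_chain :: "'d set set \<Rightarrow> ('d, 'k::field) chain" where
  "unit_chain s \<equiv> basis_chain (s, {})"

lemma dart_mult_basis:
  assumes e: "e \<in> darts D" and g: "(s, X) \<in> generators D" and "circle s e \<notin> X"
  shows "dart_mult e (basis_chain (s, X)) =
    (if basedart D \<in> circle s e then 0 else basis_chain (s, insert (circle s e) X))"
proof (rule ext, clarify)
  fix t Y
  have "circle s e \<in> circles D s" using e by (simp add: circles_eq)
  then show "dart_mult e (basis_chain (s, X)) (t, Y) =
    (if basedart D \<in> circle s e then 0 else basis_chain (s, insert (circle s e) X)) (t, Y)"
    using g assms(3) by (auto simp: dart_mult_def basis_chain_def generators_iff)
qed

lemma unit_in_generators: "(s, {}) \<in> generators D \<longleftrightarrow> s \<subseteq> crossings D"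
  by (simp add: generators_iff)

text \<open>The unit chains generate the module: a basis chain arises from the unit chain of its
  resolution by putting on the labels x one circle at a time, each through some dart of that
  circle.\<close>

lemma mult_linear_eqI:
  fixes T U :: "('d, 'k::field) chain \<Rightarrow> ('d, 'k) chain"
  assumes T: "mult_linear T" and U: "mult_linear U"
    and eq: "\<And>s. s \<subseteq> crossings D \<Longrightarrow> T (unit_chain s) = U (unit_chain s)"
    and f: "f \<in> supported"
  shows "T f = U f"
proof -
  have basis: "T (basis_chain (s, X)) = U (basis_chain (s, X))" if "(s, X) \<in> generators D" for s X
  proof -
    have "finite X" using that finite_free_circles by (auto simp: generators_def intro: finite_subset)
    then show ?thesis using that
    proof (induction X)
      case empty
      then show ?case using eq by (simp add: unit_in_generators)
    next
      case (insert c X)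
      have g: "(s, X) \<in> generators D" "c \<in> circles D s" "basedart D \<notin> c"
        using insert.prems by (auto simp: generators_iff)
      then obtain e where e: "e \<in> darts D" "c = circle s e" by (auto simp: circles_eq)
      then have b: "basis_chain (s, insert c X) = dart_mult e (basis_chain (s, X) :: ('d, 'k) chain)"
        using insert.hyps(2) g(3) by (simp add: dart_mult_basis[OF e(1) g(1)])
      show ?case
        unfolding b mult_linearD(3)[OF T e(1) supported_basis[OF g(1)]]
          mult_linearD(3)[OF U e(1) supported_basis[OF g(1)]] insert.IH[OF g(1)] ..
    qed
  qed
  have "V f = (\<Sum>g\<in>generators D. scale (f g) (V (basis_chain g)))" if "mult_linear V" for V
  proof -
    note lin = mult_linearD(1)[OF that]
    have "V f = V (\<Sum>g\<in>generators D. scale (f g) (basis_chain g))"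
      using supported_expand[OF f] by simp
    also have "\<dots> = (\<Sum>g\<in>generators D. scale (f g) (V (basis_chain g)))"
      by (simp only: linear_op_sum[OF lin] linear_op_scale[OF lin])
    finally show ?thesis .
  qed
  note expand = this
  show ?thesis
    unfolding expand[OF T] expand[OF U] by (rule sum.cong) (use basis in auto)
qed

text \<open>The comultiplication of 1, x on one circle plus x on the other, taken as an operator at
  the crossing of \<open>d\<close>.\<close>

definition opposite_mult :: "'d \<Rightarrow> ('d, 'k::field) chain \<Rightarrow> ('d, 'k) chain" where
  "opposite_mult d f = dart_mult d f + dart_mult (opp d) f"

lemma mult_linear_opposite_mult: "mult_linear (opposite_mult d)"
  unfolding opposite_mult_def by (intro mult_linear_add mult_linear_dart_mult)

lemma opposite_mult_commute:
  assumes T: "mult_linear T" and "d \<in> crossing_darts D" "f \<in> supported"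
  shows "T (opposite_mult d f) = opposite_mult d (T f)"
proof -
  have "d \<in> darts D" "opp d \<in> darts D" using assms rot_in by (auto simp: crossing_darts_def)
  then show ?thesis
    unfolding opposite_mult_def linear_op_add[OF mult_linearD(1)[OF T]]
    using mult_linearD(3)[OF T _ assms(3)] by simp
qed

lemma dart_mult_cong:
  assumes "circle s d = circle s e" "s \<subseteq> crossings D" "d \<in> darts D" "e \<in> darts D"
  shows "dart_mult d (unit_chain s) = dart_mult e (unit_chain s)"
  using assms by (simp add: dart_mult_basis unit_in_generators)

lemma saddle_unit_other:
  assumes "s \<subseteq> crossings D" "v \<in> crossings D" "toggle v t \<noteq> s \<or> (t, X') \<notin> generators D"
  shows "saddle v (unit_chain s) (t, X') = 0"
  using assms(3) by (elim disjE) (simp_all add: saddle_def basis_chain_def)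

lemma saddle_unit_merge:
  assumes d: "d \<in> crossing_darts D" and s: "s \<subseteq> crossings D" and ne: "circle s d \<noteq> circle s (opp d)"
  shows "saddle (orbit (rot D) d) (unit_chain s :: ('d, 'k::field) chain) =
    unit_chain (toggle (orbit (rot D) d) s)"
proof (rule ext, clarify)
  fix t X'
  let ?v = "orbit (rot D) d"
  have v: "?v \<in> crossings D" using crossing_in[OF d] .
  show "saddle ?v (unit_chain s :: ('d, 'k) chain) (t, X') = unit_chain (toggle ?v s) (t, X')"
  proof (cases "toggle ?v t = s \<and> (t, X') \<in> generators D")
    case True
    then have "s = toggle ?v t" "(t, X') \<in> generators D" by auto
    then show ?thesis
      by (simp only: saddle_merge[OF d _ _ ne]) (auto simp: basis_chain_def)
  next
    case False
    have "(t, X') \<noteq> (toggle ?v s, {})"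
      using False s toggle_crossings[OF v, of s] unit_in_generators[of "toggle ?v s"] by auto
    then have "unit_chain (toggle ?v s) (t, X') = (0::'k)" by (simp add: basis_chain_def)
    then show ?thesis using False by (simp add: saddle_unit_other[OF s v])
  qed
qed

text \<open>The two new circles are those through \<open>d\<close> and \<open>opp d\<close>. If one
  of them carries the basepoint, its term disappears on both sides.\<close>

lemma saddle_unit_split:
  assumes d: "d \<in> crossing_darts D" and s: "s \<subseteq> crossings D" and eq: "circle s d = circle s (opp d)"
  shows "saddle (orbit (rot D) d) (unit_chain s :: ('d, 'k::field) chain) =
    opposite_mult d (unit_chain (toggle (orbit (rot D) d) s))"
proof (rule ext, clarify)
  fix t X'
  let ?v = "orbit (rot D) d"
  have v: "?v \<in> crossings D" using crossing_in[OF d] .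
  show "saddle ?v (unit_chain s :: ('d, 'k) chain) (t, X') = opposite_mult d (unit_chain (toggle ?v s)) (t, X')"
  proof (cases "toggle ?v t = s \<and> (t, X') \<in> generators D")
    case True
    then have g: "s = toggle ?v t" "(t, X') \<in> generators D" by auto
    have ts: "toggle ?v s = t" using g by simp
    have ne: "circle t d \<noteq> circle t (opp d)" using circle_toggle_split[OF d eq] ts by simp
    let ?B = "circle t d" and ?C = "circle t (opp d)"
    have "saddle ?v (unit_chain s :: ('d, 'k) chain) (t, X') =
      (if X' = {?B} then 1 else if X' = {?C} then 1 else 0)"
      unfolding saddle_split[OF d g(2,1) ne] using ne by (auto simp: basis_chain_def)
    moreover have "opposite_mult d (unit_chain t :: ('d, 'k) chain) (t, X') =
      (if X' = {?B} then 1 else if X' = {?C} then 1 else 0)"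
      using ne g(2) by (auto simp: opposite_mult_def dart_mult_def basis_chain_def)
    ultimately show ?thesis by (simp add: ts)
  next
    case False
    then have "saddle ?v (unit_chain s :: ('d, 'k) chain) (t, X') = 0"
      by (simp add: saddle_unit_other[OF s v])
    moreover have "opposite_mult d (unit_chain (toggle ?v s) :: ('d, 'k) chain) (t, X') = 0"
      using False by (auto simp: opposite_mult_def dart_mult_def basis_chain_def)
    ultimately show ?thesis by simp
  qed
qed

text \<open>This turns the question whether saddles merge or split into arithmetic: two orders of
  toggling end with the same number of circles, hence contain equally many splits.\<close>

lemma card_circles_toggle:
  assumes d: "d \<in> crossing_darts D"
  shows "int (card (circles D (toggle (orbit (rot D) d) s))) =
    int (card (circles D s)) + (if circle s d = circle s (opp d) then 1 else - 1)"
proof -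
  have merge: "card (circles D s) = card (circles D (toggle (orbit (rot D) d) s)) + 1"
    if ne: "circle s d \<noteq> circle s (opp d)" for s
  proof -
    obtain R where R: "circles D s = insert (circle s d) (insert (circle s (opp d)) R)"
      "circles D (toggle (orbit (rot D) d) s) = insert (circle s d \<union> circle s (opp d)) R"
      "circle s d \<notin> R" "circle s (opp d) \<notin> R" "circle s d \<union> circle s (opp d) \<notin> R"
      by (rule circles_toggle[OF d ne])
    have "finite R" using finite_circles[of s] unfolding R(1) by simp
    then show ?thesis unfolding R(1,2) using R(3-5) ne by simp
  qed
  show ?thesis
  proof (cases "circle s d = circle s (opp d)")
    case True
    then show ?thesis using merge[OF circle_toggle_split[OF d True]] by simp
  next
    case False
    then show ?thesis using merge[OF False] by simp
  qed
qed

text \<open>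
  If both crossings merge circles of \<open>s\<close> but the second of them splits a circle, they join the
  same two circles.
\<close>

lemma opposite_mult_double_merge:
  assumes d: "d \<in> crossing_darts D" and e: "e \<in> crossing_darts D" and s: "s \<subseteq> crossings D"
    and v: "v = orbit (rot D) d" and u: "u = orbit (rot D) e"
    and nd: "circle s d \<noteq> circle s (opp d)" and ne: "circle s e \<noteq> circle s (opp e)"
    and se: "circle (toggle v s) e = circle (toggle v s) (opp e)"
    and sd: "circle (toggle u s) d = circle (toggle u s) (opp d)"
  shows "opposite_mult d (unit_chain (toggle u (toggle v s))) =
    opposite_mult e (unit_chain (toggle u (toggle v s)))"
proof -
  let ?t = "toggle u (toggle v s)"
  have t: "?t \<subseteq> crossings D"
    using s toggle_crossings crossing_in[OF d] crossing_in[OF e] unfolding u v by metis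
  have darts: "d \<in> darts D" "opp d \<in> darts D" "e \<in> darts D" "opp e \<in> darts D"
    using d e rot_in by (auto simp: crossing_darts_def)
  define c where "c = circle s d \<union> circle s (opp d)"
  have vs: "circle (toggle v s) f = (if f \<in> c then c else circle s f)" if "f \<in> darts D" for f
    using circle_toggle_merge[OF d nd that] by (simp add: v c_def)
  have "e \<in> c"
  proof (rule ccontr)
    assume "e \<notin> c"
    then show False
      using vs[OF darts(3)] vs[OF darts(4)] se ne self_in_circle[of e "toggle v s"] by (auto split: if_splits)
  qed
  then have ce: "circle (toggle v s) e = c" using vs[OF darts(3)] by simp
  have nt: "circle ?t e \<noteq> circle ?t (opp e)" using circle_toggle_split[OF e se] by (simp add: u)
  have "toggle v s = toggle u ?t" by simp
  \<comment> \<open>Toggling \<open>u\<close> back merges two circles into \<open>c\<close>. Since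
    \<open>d\<close> and \<open>opp d\<close> lie on \<open>c\<close> but end on different circles,
    they occupy the same two circles as \<open>e\<close> and \<open>opp e\<close>, possibly
    swapped.\<close>
  then have c_eq: "c = circle ?t e \<union> circle ?t (opp e)"
    using circle_toggle_merge[OF e nt darts(3)] ce self_in_circle[of e ?t] by (simp add: u)
  have in_c: "circle ?t x = circle ?t e \<or> circle ?t x = circle ?t (opp e)" if "x \<in> c" for x
    using that circle_eqI unfolding c_eq by blast
  have "d \<in> c" "opp d \<in> c" unfolding c_def using self_in_circle by blast+
  then have "circle ?t d = circle ?t e \<or> circle ?t d = circle ?t (opp e)"
    "circle ?t (opp d) = circle ?t e \<or> circle ?t (opp d) = circle ?t (opp e)"
    using in_c by blast+
  moreover have "circle ?t d \<noteq> circle ?t (opp d)"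
    using circle_toggle_split[OF d sd] by (simp add: v[symmetric] toggle_commute)
  ultimately consider "circle ?t d = circle ?t e" "circle ?t (opp d) = circle ?t (opp e)"
    | "circle ?t d = circle ?t (opp e)" "circle ?t (opp d) = circle ?t e"
    by metis
  then show ?thesis
  proof cases
    case 1
    show ?thesis
      unfolding opposite_mult_def
      by (simp only: dart_mult_cong[OF 1(1) t darts(1,3)] dart_mult_cong[OF 1(2) t darts(2,4)])
  next
    case 2
    show ?thesis
      unfolding opposite_mult_def dart_mult_cong[OF 2(1) t darts(1,4)] dart_mult_cong[OF 2(2) t darts(2,3)]
      by (rule add.commute)
  qed
qed

end

section \<open>Relations between the saddle maps in characteristic 2\<close>

locale char2_knot_diagram = knot_diagram D for D :: "'d diagram" +
  fixes w :: "'d set \<Rightarrow> 'k::field"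
  assumes char2: "(1::'k) + 1 = 0"
begin

lemma add_self: "(a::'k) + a = 0"
  using char2 by (metis distrib_right mult_1 mult_zero_left)

lemma add_self_fun: "(f::'g \<Rightarrow> 'k) + f = 0"
  by (rule ext) (simp only: plus_fun_apply zero_fun_apply add_self)

lemma add_self_left: "(f::'g \<Rightarrow> 'k) + (f + g) = g"
  using add_self_fun[of f] by (simp only: add.assoc[symmetric] add_0)

text \<open>On a common circle the operator is 2x.\<close>

lemma opposite_mult_zero:
  assumes d: "d \<in> crossing_darts D" and s: "s \<subseteq> crossings D" and eq: "circle s d = circle s (opp d)"
  shows "opposite_mult d (unit_chain s :: ('d, 'k) chain) = 0"
proof -
  have "d \<in> darts D" "opp d \<in> darts D" using d rot_in by (auto simp: crossing_darts_def)
  then show ?thesis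
    unfolding opposite_mult_def by (simp only: dart_mult_cong[OF eq s] add_self_fun)
qed

lemma unit_supported: "s \<subseteq> crossings D \<Longrightarrow> unit_chain s \<in> supported"
  by (simp add: supported_basis unit_in_generators)

lemma toggle_subset:
  "d \<in> crossing_darts D \<Longrightarrow> s \<subseteq> crossings D \<Longrightarrow> toggle (orbit (rot D) d) s \<subseteq> crossings D"
  using toggle_crossings crossing_in by blast

text \<open>Of the two passes through the crossing one is a merge, which preserves 1, and the other
  a split, which produces \<open>opposite_mult d\<close>; this operator commutes with the
  saddle.\<close>

lemma saddle_square:
  assumes d: "d \<in> crossing_darts D" and f: "(f :: ('d, 'k) chain) \<in> supported"
  shows "saddle (orbit (rot D) d) (saddle (orbit (rot D) d) f) = opposite_mult d f"
proof (rule mult_linear_eqI[OF _ mult_linear_opposite_mult _ f])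
  let ?v = "orbit (rot D) d"
  show "mult_linear (\<lambda>f :: ('d, 'k) chain. saddle ?v (saddle ?v f))"
    by (rule mult_linear_comp[OF mult_linear_saddle[OF d] mult_linear_saddle[OF d]])
  fix s assume s: "s \<subseteq> crossings D"
  let ?t = "toggle ?v s"
  have t: "?t \<subseteq> crossings D" using toggle_subset[OF d s] .
  show "saddle ?v (saddle ?v (unit_chain s :: ('d, 'k) chain)) = opposite_mult d (unit_chain s)"
  proof (cases "circle s d = circle s (opp d)")
    case True
    note nt = circle_toggle_split[OF d True]
    show ?thesis
      by (simp only: saddle_unit_split[OF d s True] saddle_unit_merge[OF d t nt] toggle_toggle
        opposite_mult_commute[OF mult_linear_saddle[OF d] d unit_supported[OF t]])
  next
    case False
    have "circle ?t d = circle ?t (opp d)"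
      using circles_toggle[OF d False] by metis
    from saddle_unit_split[OF d t this] show ?thesis
      by (simp only: saddle_unit_merge[OF d s False] toggle_toggle)
  qed
qed

text \<open>The darts \<open>d\<close> and \<open>opp d\<close> lie on one circle either before or
  after the remaining saddle. There \<open>opposite_mult d\<close> vanishes, and it may be moved to
  either side.\<close>

lemma saddle_cube:
  assumes d: "d \<in> crossing_darts D" and f: "(f :: ('d, 'k) chain) \<in> supported"
  shows "saddle (orbit (rot D) d) (saddle (orbit (rot D) d) (saddle (orbit (rot D) d) f)) = 0"
proof -
  let ?v = "orbit (rot D) d"
  have "saddle ?v (opposite_mult d f) = 0"
  proof (rule mult_linear_eqI[OF _ mult_linear_zero _ f])
    show "mult_linear (\<lambda>f :: ('d, 'k) chain. saddle ?v (opposite_mult d f))"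
      by (rule mult_linear_comp[OF mult_linear_saddle[OF d] mult_linear_opposite_mult])
    fix s assume s: "s \<subseteq> crossings D"
    let ?t = "toggle ?v s"
    have t: "?t \<subseteq> crossings D" using toggle_subset[OF d s] .
    show "saddle ?v (opposite_mult d (unit_chain s :: ('d, 'k) chain)) = 0"
    proof (cases "circle s d = circle s (opp d)")
      case True
      show ?thesis
        by (simp only: opposite_mult_zero[OF d s True] linear_op_zero[OF linear_saddle])
    next
      case False
      have eq: "circle ?t d = circle ?t (opp d)"
        using circles_toggle[OF d False] by metis
      show ?thesis
        by (simp only: opposite_mult_commute[OF mult_linear_saddle[OF d] d unit_supported[OF s]]
            saddle_unit_merge[OF d s False] opposite_mult_zero[OF d t eq])
    qed
  qed
  then show ?thesis
    by (simp only: saddle_square[OF d saddle_supported] opposite_mult_commute[OF mult_linear_saddle[OF d] d f])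
qed

text \<open>On a unit chain each order yields the product of \<open>?D\<close> and \<open>?E\<close>
  over those of its saddles that split, so only the patterns of merges and splits have to be
  compared.\<close>

lemma saddle_commute:
  assumes v: "v \<in> crossings D" and u: "u \<in> crossings D" and "u \<noteq> v"
    and f: "(f :: ('d, 'k) chain) \<in> supported"
  shows "saddle u (saddle v f) = saddle v (saddle u f)"
proof -
  obtain d e where d: "d \<in> crossing_darts D" "v = orbit (rot D) d"
    and e: "e \<in> crossing_darts D" "u = orbit (rot D) e"
    using u v by (auto simp: crossings_def)
  note ml = mult_linear_saddle[OF d(1), folded d(2)] mult_linear_saddle[OF e(1), folded e(2)]
  show ?thesis
  proof (rule mult_linear_eqI[OF _ _ _ f])
    show "mult_linear (\<lambda>f :: ('d, 'k) chain. saddle u (saddle v f))"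
      "mult_linear (\<lambda>f :: ('d, 'k) chain. saddle v (saddle u f))"
      by (rule mult_linear_comp[OF ml(2,1)], rule mult_linear_comp[OF ml])
    fix s assume s: "s \<subseteq> crossings D"
    let ?t = "toggle u (toggle v s)"
    let ?D = "opposite_mult d :: ('d, 'k) chain \<Rightarrow> ('d, 'k) chain"
    let ?E = "opposite_mult e :: ('d, 'k) chain \<Rightarrow> ('d, 'k) chain"
    let ?one = "unit_chain ?t :: ('d, 'k) chain"
    have vs: "toggle v s \<subseteq> crossings D" and us: "toggle u s \<subseteq> crossings D"
      and t: "?t \<subseteq> crossings D"
      using toggle_crossings[OF v] toggle_crossings[OF u] s by auto
    define a b a' b' where "a \<longleftrightarrow> circle s d = circle s (opp d)"
      and "b \<longleftrightarrow> circle s e = circle s (opp e)"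
      and "a' \<longleftrightarrow> circle (toggle u s) d = circle (toggle u s) (opp d)"
      and "b' \<longleftrightarrow> circle (toggle v s) e = circle (toggle v s) (opp e)"
    note ab = a_def b_def a'_def b'_def
    have sv: "saddle v (unit_chain r :: ('d, 'k) chain) =
        (if circle r d = circle r (opp d) then ?D (unit_chain (toggle v r)) else unit_chain (toggle v r))"
      if "r \<subseteq> crossings D" for r
      by (simp add: saddle_unit_split[OF d(1) that] saddle_unit_merge[OF d(1) that] d(2))
    have su: "saddle u (unit_chain r :: ('d, 'k) chain) =
        (if circle r e = circle r (opp e) then ?E (unit_chain (toggle u r)) else unit_chain (toggle u r))"
      if "r \<subseteq> crossings D" for r
      by (simp add: saddle_unit_split[OF e(1) that] saddle_unit_merge[OF e(1) that] e(2))
    have uv: "saddle u (saddle v (unit_chain s :: ('d, 'k) chain)) =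
        (if a then (if b' then ?D (?E ?one) else ?D ?one) else (if b' then ?E ?one else ?one))"
      unfolding sv[OF s] ab
      by (simp add: opposite_mult_commute[OF ml(2) d(1) unit_supported[OF vs]] su[OF vs])
    have vu: "saddle v (saddle u (unit_chain s :: ('d, 'k) chain)) =
        (if b then (if a' then ?E (?D ?one) else ?E ?one) else (if a' then ?D ?one else ?one))"
      unfolding su[OF s] ab
      by (simp add: opposite_mult_commute[OF ml(1) e(1) unit_supported[OF us]] sv[OF us]
        toggle_commute[of v u s])
    \<comment> \<open>Both orders contain equally many splits. They can only disagree if each has
      one split, at different crossings: if the split comes first in both orders, both results
      vanish by \<open>mE\<close> and \<open>mD\<close>; if the merge comes first in both, the
      results agree by \<open>both\<close>.\<close>
    have count: "(if a then 1 else - 1 :: int) + (if b' then 1 else - 1) =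
        (if b then 1 else - 1) + (if a' then 1 else - 1)"
      using card_circles_toggle[OF d(1), of s] card_circles_toggle[OF e(1), of "toggle v s"]
        card_circles_toggle[OF e(1), of s] card_circles_toggle[OF d(1), of "toggle u s"]
      unfolding ab d(2)[symmetric] e(2)[symmetric] toggle_commute[of v u s] by linarith
    have DE: "?D (?E ?one) = ?E (?D ?one)"
      by (rule opposite_mult_commute[OF mult_linear_opposite_mult e(1) unit_supported[OF t]])
    have mE: "?E ?one = 0" if "\<not> b'"
    proof (rule opposite_mult_zero[OF e(1) t])
      show "circle ?t e = circle ?t (opp e)"
        using that circles_toggle[OF e(1), of "toggle v s"] unfolding ab e(2) by metis
    qed
    have mD: "?D ?one = 0" if "\<not> a'"
    proof (rule opposite_mult_zero[OF d(1) t])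
      show "circle ?t d = circle ?t (opp d)"
        using that circles_toggle[OF d(1), of "toggle u s"]
        unfolding ab d(2) toggle_commute[of u] by metis
    qed
    have both: "?D ?one = ?E ?one" if "\<not> a" "\<not> b" "a'" "b'"
      using opposite_mult_double_merge[OF d(1) e(1) s d(2) e(2)] that unfolding ab by blast
    show "saddle u (saddle v (unit_chain s :: ('d, 'k) chain)) = saddle v (saddle u (unit_chain s))"
      unfolding uv vu using count DE mE mD both by (auto split: if_splits)
  qed
qed

end

section \<open>The differential as a sum of upward saddle maps\<close>

context knot_diagram
begin

definition part :: "'d set \<Rightarrow> bool \<Rightarrow> ('d, 'k::field) chain \<Rightarrow> ('d, 'k) chain" where
  "part v b f = (\<lambda>(s, X). if (v \<in> s) = b then f (s, X) else 0)"

lemma linear_part: "linear_op (part v b)"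
  by (rule linear_opI) (auto simp: part_def scale_def fun_eq_iff)

lemma part_supported: "f \<in> supported \<Longrightarrow> part v b f \<in> supported"
  by (auto simp: supported_def part_def)

lemma saddle_part: "saddle v (part v b f) = part v (\<not> b) (saddle v f)"
  by (rule ext) (auto simp: part_def saddle_def in_toggle intro!: sum.neutral)

lemma saddle_part_other:
  assumes "u \<noteq> v"
  shows "saddle u (part v b f) = part v b (saddle u f)"
  using assms by (intro ext, clarify) (simp add: part_def saddle_def in_toggle)

lemma part_part: "part v b (part v c f) = (if b = c then part v b f else 0)"
  by (rule ext) (cases b; cases c; auto simp: part_def)

lemma part_commute: "part v b (part u c f) = part u c (part v b f)"
  by (rule ext) (auto simp: part_def)

lemma part_sum: "part v b f + part v (\<not> b) f = f"
  by (rule ext) (auto simp: part_def)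

definition up :: "'d set \<Rightarrow> ('d, 'k::field) chain \<Rightarrow> ('d, 'k) chain" where
  "up v f = part v True (saddle v f)"

text \<open>The map h_v of the overview.\<close>

definition down :: "'d set \<Rightarrow> ('d, 'k::field) chain \<Rightarrow> ('d, 'k) chain" where
  "down v f = part v False (saddle v f)"

lemma linear_up: "linear_op (up v)" and linear_down: "linear_op (down v)"
  unfolding up_def down_def by (rule linear_op_comp[OF linear_part linear_saddle])+

lemma down_supported: "down v f \<in> supported"
  by (simp add: down_def part_supported saddle_supported)

lemma up_supported: "up v f \<in> supported"
  by (simp add: up_def part_supported saddle_supported)

lemma local_edge_khovanov:
  "khovanov_edge D (s, X) (s', X') \<longleftrightarrow>
     (\<exists>v. v \<in> crossings D \<and> v \<notin> s \<and> s' = insert v s) \<and> local_edge s s' X X'"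
  unfolding khovanov_edge_def local_edge_def by simp

text \<open>An edge of the cube into the resolution \<open>t\<close> is given by the crossing
  \<open>v\<close> in \<open>t\<close> that it adds; its source is \<open>t - {v}\<close>. So the
  sum over source generators splits by \<open>v\<close>.\<close>

lemma khovanov_d_up: "khovanov_d D f = (\<Sum>v\<in>crossings D. up v f)"
proof (rule ext, clarify)
  fix t X'
  show "khovanov_d D f (t, X') = (\<Sum>v\<in>crossings D. up v f) (t, X')"
  proof (cases "(t, X') \<in> generators D")
    case False
    then show ?thesis
      by (auto simp: khovanov_d_def sum_fun_apply up_def part_def saddle_def intro!: sum.neutral)
  next
    case g: True
    then have t: "t \<subseteq> crossings D" by (simp add: generators_iff)
    let ?L = "\<lambda>v. {X. X \<subseteq> free_circles D (t - {v}) \<and> local_edge (t - {v}) t X X'}"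
    let ?F = "\<lambda>(v, X). (t - {v}, X)"
    have fin: "finite t" "\<And>v. finite (?L v)"
      using t finite_crossings finite_free_circles by (auto intro: finite_subset)
    have set_eq: "{g. g \<in> generators D \<and> khovanov_edge D g (t, X')} = ?F ` (SIGMA v:t. ?L v)"
    proof (intro Set.set_eqI iffI)
      fix g assume "g \<in> {g. g \<in> generators D \<and> khovanov_edge D g (t, X')}"
      then obtain s X v where gX: "g = (s, X)" "X \<subseteq> free_circles D s" "v \<notin> s" "t = insert v s" "local_edge s t X X'"
        by (cases g) (auto simp: local_edge_khovanov generators_def)
      then have "s = t - {v}" by auto
      then have "g = ?F (v, X)" "(v, X) \<in> (SIGMA v:t. ?L v)" using gX by auto
      then show "g \<in> ?F ` (SIGMA v:t. ?L v)" by (rule image_eqI)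
    next
      fix g assume "g \<in> ?F ` (SIGMA v:t. ?L v)"
      then obtain v X where gX: "g = (t - {v}, X)" "v \<in> t" "X \<subseteq> free_circles D (t - {v})"
        "local_edge (t - {v}) t X X'"
        by auto
      have "khovanov_edge D (t - {v}, X) (t, X')"
        unfolding local_edge_khovanov using gX t by (intro conjI exI[of _ v]) auto
      then show "g \<in> {g. g \<in> generators D \<and> khovanov_edge D g (t, X')}"
        using t gX(1,3) by (auto simp: generators_def)
    qed
    have inj: "inj_on ?F (SIGMA v:t. ?L v)"
      by (auto simp: inj_on_def)
    have "khovanov_d D f (t, X') = (\<Sum>(v, X)\<in>(SIGMA v:t. ?L v). f (t - {v}, X))"
    proof -
      have "khovanov_d D f (t, X') = sum f (?F ` (SIGMA v:t. ?L v))"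
        by (simp only: khovanov_d_def g if_True set_eq)
      also have "\<dots> = sum (f \<circ> ?F) (SIGMA v:t. ?L v)" by (rule sum.reindex[OF inj])
      also have "\<dots> = (\<Sum>(v, X)\<in>(SIGMA v:t. ?L v). f (t - {v}, X))"
        by (rule sum.cong) auto
      finally show ?thesis .
    qed
    also have "\<dots> = (\<Sum>v\<in>t. \<Sum>X\<in>?L v. f (t - {v}, X))"
      using fin by (simp add: sum.Sigma)
    also have "\<dots> = (\<Sum>v\<in>t. up v f (t, X'))"
      by (rule sum.cong) (use g in \<open>simp_all add: up_def part_def saddle_def toggle_def\<close>)
    also have "\<dots> = (\<Sum>v\<in>crossings D. up v f (t, X'))"
      by (rule sum.mono_neutral_left[OF finite_crossings t]) (auto simp: up_def part_def)
    finally show ?thesis by (simp add: sum_fun_apply)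
  qed
qed

lemma linear_khovanov_d: "linear_op (khovanov_d D)"
proof (rule linear_opI)
  show "khovanov_d D (f + g) = khovanov_d D f + khovanov_d D g" for f g :: "('d, 'k::field) chain"
    unfolding khovanov_d_up by (simp only: linear_op_add[OF linear_up] sum.distrib)
  show "khovanov_d D (scale a f) = scale a (khovanov_d D f)" for a and f :: "('d, 'k::field) chain"
    unfolding khovanov_d_up by (simp only: linear_op_scale[OF linear_up] scale_sum)
qed

section \<open>The downward saddle maps preserve the delta grading\<close>

text \<open>In twice the homological degree minus the q-degree the two contributions of
  \<open>n_minus D\<close> cancel.\<close>

lemma delta_grading_generator:
  assumes "(s, X) \<in> generators D"
  shows "delta_grading D (s, X) =
    int (card s) - int (card (free_circles D s)) + 2 * int (card X) - int (n_plus D)"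
proof -
  have X: "X \<subseteq> free_circles D s" using assms by (simp add: generators_def)
  then have "int (card (free_circles D s - X)) = int (card (free_circles D s)) - int (card X)"
    using finite_free_circles by (simp add: card_Diff_subset card_mono finite_subset of_nat_diff)
  then show ?thesis by (simp add: delta_grading_def h_grading_def q_grading_def)
qed

text \<open>At most one of the two circles carries the basepoint, and then so does their union. So
  one free circle is lost in any case.\<close>

lemma card_free_circles_merge:
  assumes d: "d \<in> crossing_darts D" and ne: "circle s d \<noteq> circle s (opp d)"
  shows "card (free_circles D s) = card (free_circles D (toggle (orbit (rot D) d) s)) + 1"
proof -
  let ?A = "circle s d" and ?B = "circle s (opp d)" and ?t = "toggle (orbit (rot D) d) s"
  obtain R where R: "circles D s = insert ?A (insert ?B R)" "circles D ?t = insert (?A \<union> ?B) R"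
    "?A \<notin> R" "?B \<notin> R" "?A \<union> ?B \<notin> R"
    by (rule circles_toggle[OF d ne])
  define F where "F = {c \<in> R. basedart D \<notin> c}"
  have "finite R" using finite_circles[of s] unfolding R(1) by simp
  then have fin: "finite F" by (simp add: F_def)
  have nF: "?A \<notin> F" "?B \<notin> F" "?A \<union> ?B \<notin> F" using R(3-5) by (auto simp: F_def)
  have notboth: "\<not> (basedart D \<in> ?A \<and> basedart D \<in> ?B)"
    using ne circle_eqI by metis
  have fs: "free_circles D s = (if basedart D \<in> ?A then {} else {?A}) \<union> (if basedart D \<in> ?B then {} else {?B}) \<union> F"
    unfolding free_circles_def R(1) F_def by auto
  have ft: "free_circles D ?t = (if basedart D \<in> ?A \<or> basedart D \<in> ?B then {} else {?A \<union> ?B}) \<union> F"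
    unfolding free_circles_def R(2) F_def by auto
  show ?thesis unfolding fs ft using notboth nF ne fin by auto
qed

text \<open>Removing \<open>v\<close> lowers \<open>card s\<close> by 1. A merge also loses one free
  circle and keeps the number of labels x; a split gains one free circle and one label x. By
  \<open>delta_grading_generator\<close> the changes cancel in both cases.\<close>

lemma down_chains:
  assumes v: "v \<in> crossings D" and f: "f \<in> chains D k"
  shows "down v f \<in> chains D k"
  unfolding chains_def
proof (intro CollectI allI impI)
  fix g assume nz: "down v f g \<noteq> 0"
  obtain t X' where g: "g = (t, X')" by (cases g)
  obtain d where d: "d \<in> crossing_darts D" "v = orbit (rot D) d"
    using v by (auto simp: crossings_def)
  have vt: "v \<notin> t" and sz: "saddle v f (t, X') \<noteq> 0"
    using nz unfolding g down_def part_def by (auto split: if_splits)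
  have gen: "(t, X') \<in> generators D"
    using sz by (auto simp: saddle_def split: if_splits)
  define s where "s = toggle (orbit (rot D) d) t"
  have s: "s = insert v t" and ts: "t = toggle (orbit (rot D) d) s"
    using vt by (auto simp: s_def toggle_def d(2))
  have fint: "finite t" using gen finite_crossings by (auto simp: generators_iff intro: finite_subset)
  then have cs: "card s = card t + 1" using vt by (simp add: s)
  have finX: "finite X'"
    using gen finite_free_circles by (auto simp: generators_def intro: finite_subset)
  have fk: "(s, X) \<in> generators D \<and> delta_grading D (s, X) = k" if "f (s, X) \<noteq> 0" for X
    using f that by (auto simp: chains_def)
  have "delta_grading D (t, X') = k"
  proof (cases "circle s d = circle s (opp d)")
    case False
    let ?A = "circle s d" and ?B = "circle s (opp d)" and ?C = "circle t d"
    obtain R where R: "circles D t = insert (?A \<union> ?B) R" "?A \<notin> R" "?B \<notin> R"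
        "?A \<union> ?B \<noteq> ?A" "?A \<union> ?B \<noteq> ?B"
      using circles_toggle[OF d(1) False] ts by metis
    have "X' \<subseteq> insert (?A \<union> ?B) R" using gen unfolding generators_iff R(1) by blast
    then have AB: "?A \<notin> X'" "?B \<notin> X'" using R(2-5) by auto
    have "\<exists>X. f (s, X) \<noteq> 0 \<and> card X = card X'"
    proof (cases "?C \<in> X'")
      case True
      then have "f (s, insert ?A (X' - {?C})) \<noteq> 0 \<or> f (s, insert ?B (X' - {?C})) \<noteq> 0"
        using sz unfolding d(2) saddle_merge[OF d(1) gen s_def False] by auto
      moreover have "card (insert ?A (X' - {?C})) = card X'" "card (insert ?B (X' - {?C})) = card X'"
        using True finX AB card_Suc_Diff1[OF finX True] by simp_all
      ultimately show ?thesis by blast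
    next
      case no: False
      then show ?thesis
        using sz unfolding d(2) saddle_merge[OF d(1) gen s_def False] by auto
    qed
    then obtain X where X: "f (s, X) \<noteq> 0" "card X = card X'" by blast
    then show ?thesis
      using fk[OF X(1)] delta_grading_generator[OF gen] delta_grading_generator[of s X] cs
        card_free_circles_merge[OF d(1) False] by (simp add: ts[symmetric])
  next
    case True
    have ne: "circle t d \<noteq> circle t (opp d)" using circle_toggle_split[OF d(1) True] ts by simp
    let ?A = "circle s d" and ?B = "circle t d" and ?C = "circle t (opp d)"
    obtain R where R: "circles D t = insert ?B (insert ?C R)" "?A \<notin> R" "?A \<noteq> ?B" "?A \<noteq> ?C"
      using circles_toggle[OF d(1) ne] unfolding s_def by metis
    have "X' \<subseteq> insert ?B (insert ?C R)" using gen unfolding generators_iff R(1) by blast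
    then have A: "?A \<notin> X'" using R(2-4) by auto
    have "\<exists>X. f (s, X) \<noteq> 0 \<and> card X + 1 = card X'"
    proof (cases "?B \<in> X' \<and> ?C \<in> X'")
      case True
      have "{?B, ?C} \<subseteq> X'" "card {?B, ?C} = 2" using True ne by auto
      then have "card (X' - {?B, ?C}) + 2 = card X'"
        using finX card_mono[OF finX, of "{?B, ?C}"] by (simp add: card_Diff_subset)
      then have "card (insert ?A (X' - {?B, ?C})) + 1 = card X'" using finX A by simp
      moreover have "f (s, insert ?A (X' - {?B, ?C})) \<noteq> 0"
        using sz True unfolding d(2) saddle_split[OF d(1) gen s_def ne] by simp
      ultimately show ?thesis by blast
    next
      case False
      then have nz: "f (s, X' - {?B, ?C}) \<noteq> 0" and one: "?B \<in> X' \<or> ?C \<in> X'"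
        using sz unfolding d(2) saddle_split[OF d(1) gen s_def ne] by (auto split: if_splits)
      from one False have "X' - {?B, ?C} = X' - {?B} \<and> ?B \<in> X' \<or> X' - {?B, ?C} = X' - {?C} \<and> ?C \<in> X'"
        by auto
      then have "card (X' - {?B, ?C}) + 1 = card X'"
        using card_Suc_Diff1[OF finX] by (metis Suc_eq_plus1)
      then show ?thesis using nz by blast
    qed
    then obtain X where X: "f (s, X) \<noteq> 0" "card X + 1 = card X'" by blast
    then show ?thesis
      using fk[OF X(1)] delta_grading_generator[OF gen] delta_grading_generator[of s X] cs
        card_free_circles_merge[OF d(1) ne] by (simp add: s_def[symmetric])
  qed
  then show "g \<in> generators D \<and> delta_grading D g = k" using gen g by simp
qed

lemma chains_supported: "f \<in> chains D k \<Longrightarrow> f \<in> supported"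
  by (auto simp: chains_def supported_def)

lemma chains_add: "f \<in> chains D k \<Longrightarrow> g \<in> chains D k \<Longrightarrow> f + g \<in> chains D k"
  by (simp add: chains_def) (metis add_0)

lemma chains_scale: "f \<in> chains D k \<Longrightarrow> scale a f \<in> chains D k"
  by (simp add: chains_def scale_def)

section \<open>Isomorphic complexes have isomorphic homology\<close>

text \<open>\<open>\<Psi>\<close> is applied to cosets as sets. It maps boundaries onto boundaries,
  and all cosets consist of supported chains, where it is injective.\<close>

lemma graded_iso_homology:
  fixes T U :: "('d, 'k::field) chain \<Rightarrow> ('d, 'k) chain"
  assumes lin: "linear_op \<Psi>" and inj: "inj_on \<Psi> supported"
    and onto: "\<And>k. \<Psi> ` chains D k = chains D k"
    and U: "\<And>f. f \<in> supported \<Longrightarrow> U f \<in> supported"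
    and intertwine: "\<And>f. f \<in> supported \<Longrightarrow> \<Psi> (U f) = T (\<Psi> f)"
  shows "graded_iso (homology D U) (homology D T)"
  unfolding graded_iso_def
proof
  fix k
  have bd: "\<Psi> ` boundaries D U k = boundaries D T k"
  proof -
    have "\<Psi> ` U ` chains D (k - 2) = T ` \<Psi> ` chains D (k - 2)"
      unfolding image_image by (rule image_cong) (auto simp: intertwine chains_supported)
    then show ?thesis by (simp add: boundaries_def onto)
  qed
  have set_plus: "\<Psi> ` (V + W) = \<Psi> ` V + \<Psi> ` W" for V W
    unfolding set_plus_def by (force simp: linear_op_add[OF lin])
  have elt_plus: "\<Psi> ` (z +o V) = \<Psi> z +o \<Psi> ` V" for z V
    unfolding elt_set_plus_def by (force simp: linear_op_add[OF lin])
  have scale_image: "\<Psi> ` scale a ` V = scale a ` \<Psi> ` V" for a V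
    by (simp add: image_image linear_op_scale[OF lin])
  have zero: "\<Psi> f = 0 \<longleftrightarrow> f = 0" if "f \<in> supported" for f
    using inj_onD[OF inj _ that supported_zero] linear_op_zero[OF lin] by auto
  have bsub: "boundaries D U k \<subseteq> supported"
    using U chains_supported by (auto simp: boundaries_def)
  have carr_sub: "C \<subseteq> supported" if C: "C \<in> carrier (homology D U k)" for C
  proof
    fix f assume "f \<in> C"
    then obtain z b where "z \<in> chains D k" "b \<in> boundaries D U k" "f = z + b"
      using C by (auto simp: homology_def elt_set_plus_def)
    then show "f \<in> supported" using bsub chains_supported supported_add by blast
  qed
  have carr: "(\<lambda>C. \<Psi> ` C) ` carrier (homology D U k) = carrier (homology D T k)"
  proof (intro equalityI subsetI)
    fix C assume "C \<in> (\<lambda>C. \<Psi> ` C) ` carrier (homology D U k)"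
    then obtain z where z: "z \<in> chains D k" "U z = 0" "C = \<Psi> ` (z +o boundaries D U k)"
      by (auto simp: homology_def)
    then have "C = \<Psi> z +o boundaries D T k" by (simp only: elt_plus bd)
    moreover have "\<Psi> z \<in> chains D k" using z(1) onto by blast
    moreover have "T (\<Psi> z) = 0"
      using intertwine[OF chains_supported[OF z(1)]] z(2) linear_op_zero[OF lin] by simp
    ultimately show "C \<in> carrier (homology D T k)" by (auto simp: homology_def)
  next
    fix C assume "C \<in> carrier (homology D T k)"
    then obtain z' where z': "z' \<in> chains D k" "T z' = 0" "C = z' +o boundaries D T k"
      by (auto simp: homology_def)
    then obtain z where z: "z \<in> chains D k" "z' = \<Psi> z" using onto by blast
    note zs = chains_supported[OF z(1)]
    have "U z = 0" using intertwine[OF zs] z' z zero[OF U[OF zs]] by simp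
    then have "z +o boundaries D U k \<in> carrier (homology D U k)"
      using z(1) by (auto simp: homology_def)
    moreover have "C = \<Psi> ` (z +o boundaries D U k)" by (simp only: elt_plus bd z' z)
    ultimately show "C \<in> (\<lambda>C. \<Psi> ` C) ` carrier (homology D U k)" by blast
  qed
  show "\<exists>\<phi>. \<phi> \<in> iso (add_monoid (homology D U k)) (add_monoid (homology D T k)) \<and>
    (\<forall>a. \<forall>v\<in>carrier (homology D U k). \<phi> (a \<odot>\<^bsub>homology D U k\<^esub> v) = a \<odot>\<^bsub>homology D T k\<^esub> \<phi> v)"
  proof (intro exI[of _ "\<lambda>C. \<Psi> ` C"] conjI allI ballI)
    have "inj_on (\<lambda>C. \<Psi> ` C) (carrier (homology D U k))"
      by (rule inj_onI) (simp only: inj_on_image_eq_iff[OF inj carr_sub carr_sub])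
    then have "bij_betw (\<lambda>C. \<Psi> ` C) (carrier (homology D U k)) (carrier (homology D T k))"
      using carr by (simp add: bij_betw_def)
    moreover have "(\<lambda>C. \<Psi> ` C) \<in> hom (add_monoid (homology D U k)) (add_monoid (homology D T k))"
    proof -
      have "\<Psi> ` (V \<oplus>\<^bsub>homology D U k\<^esub> W) = \<Psi> ` V \<oplus>\<^bsub>homology D T k\<^esub> \<Psi> ` W" for V W
        by (simp add: homology_def set_plus)
      moreover have "\<Psi> ` V \<in> carrier (homology D T k)" if "V \<in> carrier (homology D U k)" for V
        using carr that by blast
      ultimately show ?thesis by (simp add: hom_def)
    qed
    ultimately show "(\<lambda>C. \<Psi> ` C) \<in> iso (add_monoid (homology D U k)) (add_monoid (homology D T k))"
      by (simp add: iso_def)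
    show "\<Psi> ` (a \<odot>\<^bsub>homology D U k\<^esub> v) = a \<odot>\<^bsub>homology D T k\<^esub> \<Psi> ` v" for a v
      using scale_image[of a v] by (simp add: homology_def set_plus bd scale_def)
  qed
qed

end

context char2_knot_diagram
begin

section \<open>Conjugating the differential\<close>

abbreviation saddle2 :: "'d set \<Rightarrow> ('d, 'k) chain \<Rightarrow> ('d, 'k) chain" where
  "saddle2 v f \<equiv> saddle v (saddle v f)"

lemma linear_saddle2: "linear_op (saddle2 v)"
  by (rule linear_op_comp[OF linear_saddle linear_saddle])

lemma down_down:
  shows "down v (down v (f :: ('d, 'k) chain)) = 0"
  unfolding down_def by (simp add: saddle_part part_part)

text \<open>For \<open>u = v\<close> the two composites are the parts of the squared saddle on the
  resolutions without and with \<open>v\<close>. For different crossings they are equal and cancel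
  in characteristic 2.\<close>

lemma down_up:
  assumes "v \<in> crossings D" "u \<in> crossings D" "(f :: ('d, 'k) chain) \<in> supported"
  shows "down v (up u f) + up u (down v f) = (if u = v then saddle2 v f else 0)"
proof (cases "u = v")
  case True
  have "down v (up v f) + up v (down v f) = part v False (saddle2 v f) + part v True (saddle2 v f)"
    by (simp add: up_def down_def saddle_part part_part)
  also have "\<dots> = saddle2 v f" using part_sum[of v False "saddle2 v f"] by simp
  finally show ?thesis using True by simp
next
  case False
  have "down v (up u f) = up u (down v f)"
    unfolding up_def down_def using False
    by (simp add: saddle_part_other part_commute[of v] saddle_commute[OF assms(1,2) False assms(3)])
  then show ?thesis using False by (simp only: add_self_fun if_False)
qed

lemma saddle2_down:
  assumes v: "v \<in> crossings D" and u: "u \<in> crossings D" and f: "(f :: ('d, 'k) chain) \<in> supported"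
  shows "down v (saddle2 u f) = saddle2 u (down v f)"
proof (cases "u = v")
  case True
  then show ?thesis by (simp add: down_def saddle_part)
next
  case False
  then show ?thesis
    by (simp add: down_def saddle_part_other saddle_commute[OF v u False] f saddle_supported)
qed

lemma saddle2_down_same:
  assumes v: "v \<in> crossings D" and f: "(f :: ('d, 'k) chain) \<in> supported"
  shows "saddle2 v (down v f) = 0"
proof -
  obtain d where "d \<in> crossing_darts D" "v = orbit (rot D) d" using v by (auto simp: crossings_def)
  then have "saddle v (saddle v (saddle v f)) = 0" using saddle_cube[OF _ f] by simp
  then show ?thesis
    by (simp add: down_def saddle_part linear_op_zero[OF linear_part])
qed

lemma down_khovanov_d:
  assumes v: "v \<in> crossings D" and f: "(f :: ('d, 'k) chain) \<in> supported"
  shows "down v (khovanov_d D f) = khovanov_d D (down v f) + saddle2 v f"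
proof -
  have "down v (khovanov_d D f) + khovanov_d D (down v f) =
    (\<Sum>u\<in>crossings D. if u = v then saddle2 v f else 0)"
    unfolding khovanov_d_up linear_op_sum[OF linear_down] sum.distrib[symmetric]
    by (rule sum.cong) (simp_all only: down_up[OF v _ f])
  also have "\<dots> = saddle2 v f" using v finite_crossings by simp
  finally have "khovanov_d D (down v f) + (khovanov_d D (down v f) + down v (khovanov_d D f)) =
      khovanov_d D (down v f) + saddle2 v f"
    by (simp only: add.commute)
  then show ?thesis by (simp only: add_self_left)
qed

text \<open>The differentials between the twisted one and \<open>khovanov_d\<close>:
  \<open>V\<close> is the set of crossings whose squares are still present.\<close>

definition twisted_d :: "('d set \<Rightarrow> 'k) \<Rightarrow> 'd set set \<Rightarrow> ('d, 'k) chain \<Rightarrow> ('d, 'k) chain" where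
  "twisted_d a V f = khovanov_d D f + (\<Sum>v\<in>V. scale (a v) (saddle2 v f))"

lemma linear_twisted_d: "linear_op (twisted_d a V)"
proof (rule linear_opI)
  show "twisted_d a V (f + g) = twisted_d a V f + twisted_d a V g" for f g
    unfolding twisted_d_def linear_op_add[OF linear_khovanov_d] linear_op_add[OF linear_saddle]
      scale_add sum.distrib by (simp only: ac_simps)
  show "twisted_d a V (scale b f) = scale b (twisted_d a V f)" for b f
    unfolding twisted_d_def linear_op_scale[OF linear_khovanov_d] linear_op_scale[OF linear_saddle]
      scale_add scale_sum scale_scale by (simp only: mult.commute)
qed

lemma twisted_d_supported: "twisted_d a V f \<in> supported"
  unfolding twisted_d_def khovanov_d_up
  by (intro supported_add supported_sum supported_scale up_supported saddle_supported)

definition shear :: "'k \<Rightarrow> 'd set \<Rightarrow> ('d, 'k) chain \<Rightarrow> ('d, 'k) chain" where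
  "shear c v f = f + scale c (down v f)"

lemma linear_shear: "linear_op (shear c v)"
proof (rule linear_opI)
  show "shear c v (f + g) = shear c v f + shear c v g" for f g
    unfolding shear_def linear_op_add[OF linear_down] scale_add by (simp only: ac_simps)
  show "shear c v (scale b f) = scale b (shear c v f)" for b f
    unfolding shear_def linear_op_scale[OF linear_down] scale_add scale_scale by (simp only: mult.commute)
qed

lemma shear_supported: "f \<in> supported \<Longrightarrow> shear c v f \<in> supported"
  unfolding shear_def by (intro supported_add supported_scale down_supported)

text \<open>The square of \<open>down v\<close> is 0, and the two linear terms cancel in
  characteristic 2.\<close>

lemma shear_shear: "shear c v (shear c v f) = f"
proof -
  have "shear c v (shear c v f) = f + (scale c (down v f) + scale c (down v f))"
    unfolding shear_def linear_op_add[OF linear_down] linear_op_scale[OF linear_down] down_down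
    by (simp add: add.assoc)
  then show ?thesis by (simp only: add_self_fun add_0_right)
qed

lemma shear_chains: "v \<in> crossings D \<Longrightarrow> f \<in> chains D k \<Longrightarrow> shear c v f \<in> chains D k"
  unfolding shear_def by (intro chains_add chains_scale down_chains)

text \<open>Moving \<open>down v\<close> past the differential leaves one copy of the squared saddle
  at \<open>v\<close>, while the squares already present commute with \<open>down v\<close>.\<close>

lemma shear_twisted_d:
  assumes v: "v \<in> crossings D" and V: "V \<subseteq> crossings D" "v \<notin> V" and f: "f \<in> supported"
  shows "shear (a v) v (twisted_d a V f) = twisted_d a (insert v V) (shear (a v) v f)"
proof -
  let ?h = "down v f" and ?c = "a v"
  let ?S = "\<lambda>f. \<Sum>u\<in>V. scale (a u) (saddle2 u f)"
  have fin: "finite V" using V(1) finite_crossings finite_subset by blast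
  have hS: "down v (?S f) = ?S ?h"
    unfolding linear_op_sum[OF linear_down] linear_op_scale[OF linear_down]
    by (rule sum.cong) (use saddle2_down[OF v _ f] V(1) in auto)
  have ins: "twisted_d a (insert v V) g = twisted_d a V g + scale ?c (saddle2 v g)" for g
    unfolding twisted_d_def sum.insert[OF fin V(2)] by (simp only: ac_simps)
  have "shear ?c v (twisted_d a V f) =
    twisted_d a V f + scale ?c (khovanov_d D ?h + saddle2 v f + ?S ?h)"
    unfolding shear_def twisted_d_def linear_op_add[OF linear_down] hS down_khovanov_d[OF v f] ..
  also have "\<dots> = twisted_d a V f + (scale ?c (twisted_d a V ?h) + scale ?c (saddle2 v f))"
    unfolding twisted_d_def scale_add by (simp only: ac_simps)
  also have "\<dots> = twisted_d a V (shear ?c v f) + scale ?c (saddle2 v f)"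
    unfolding shear_def linear_op_add[OF linear_twisted_d] linear_op_scale[OF linear_twisted_d]
    by (simp only: ac_simps)
  \<comment> \<open>Here the quadratic term of the conjugation disappears: the squared saddle
    vanishes on the image of \<open>down v\<close>.\<close>
  also have "saddle2 v f = saddle2 v (shear ?c v f)"
    unfolding shear_def linear_op_add[OF linear_saddle2] linear_op_scale[OF linear_saddle2]
      saddle2_down_same[OF v f] by simp
  also have "twisted_d a V (shear ?c v f) + scale ?c (saddle2 v (shear ?c v f)) =
      twisted_d a (insert v V) (shear ?c v f)"
    by (rule ins[symmetric])
  finally show ?thesis .
qed

text \<open>\<open>\<Psi>\<close> is the composite of one shear for each crossing of
  \<open>V\<close>; every shear removes the square of its crossing.\<close>

lemma untwist:
  assumes "finite V" "V \<subseteq> crossings D"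
  shows "\<exists>\<Psi>. linear_op \<Psi> \<and> inj_on \<Psi> supported \<and> (\<forall>k. \<Psi> ` chains D k = chains D k) \<and>
    (\<forall>f\<in>supported. \<Psi> f \<in> supported) \<and>
    (\<forall>f\<in>supported. \<Psi> (twisted_d a V f) = khovanov_d D (\<Psi> f))"
  using assms
proof (induction V)
  case empty
  have "linear_op (\<lambda>f :: ('d, 'k) chain. f)" by (simp add: linear_op_def)
  moreover have "twisted_d a {} f = khovanov_d D f" for f by (simp add: twisted_d_def)
  ultimately show ?case by (intro exI[of _ "\<lambda>f. f"]) simp
next
  case (insert v V)
  then obtain \<Psi> where P: "linear_op \<Psi>" "inj_on \<Psi> supported" "\<And>k. \<Psi> ` chains D k = chains D k"
    "\<And>f. f \<in> supported \<Longrightarrow> \<Psi> f \<in> supported"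
    "\<And>f. f \<in> supported \<Longrightarrow> \<Psi> (twisted_d a V f) = khovanov_d D (\<Psi> f)"
    by (metis insert_subset)
  have v: "v \<in> crossings D" and V: "V \<subseteq> crossings D" "v \<notin> V" using insert by auto
  let ?s = "shear (a v) v"
  show ?case
  proof (intro exI[of _ "\<lambda>f. \<Psi> (?s f)"] conjI allI ballI)
    show "linear_op (\<lambda>f. \<Psi> (?s f))" by (rule linear_op_comp[OF P(1) linear_shear])
    show "inj_on (\<lambda>f. \<Psi> (?s f)) supported"
    proof (rule inj_onI)
      fix f g assume a: "f \<in> supported" "g \<in> supported" "\<Psi> (?s f) = \<Psi> (?s g)"
      then have "?s f = ?s g" using inj_onD[OF P(2)] shear_supported by metis
      then show "f = g" using shear_shear by metis
    qed
    show "(\<lambda>f. \<Psi> (?s f)) ` chains D k = chains D k" for k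
    proof -
      have "?s ` chains D k = chains D k"
      proof (intro equalityI subsetI)
        show "f \<in> chains D k" if "f \<in> ?s ` chains D k" for f using that shear_chains[OF v] by auto
        show "f \<in> ?s ` chains D k" if "f \<in> chains D k" for f
          using shear_chains[OF v that] shear_shear by (metis imageI)
      qed
      then have "\<Psi> ` ?s ` chains D k = chains D k" using P(3) by simp
      then show ?thesis by (simp add: image_image)
    qed
    fix f :: "('d, 'k) chain" assume f: "f \<in> supported"
    show "\<Psi> (?s f) \<in> supported" using P(4) shear_supported f by blast
    \<comment> \<open>As \<open>?s\<close> is its own inverse, \<open>shear_twisted_d\<close> can be
      used from right to left.\<close>
    have "?s (twisted_d a (insert v V) f) = ?s (twisted_d a (insert v V) (?s (?s f)))"
      by (simp only: shear_shear)
    also have "\<dots> = ?s (?s (twisted_d a V (?s f)))"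
      by (simp only: shear_twisted_d[OF v V shear_supported[OF f]])
    also have "\<dots> = twisted_d a V (?s f)" by (rule shear_shear)
    finally show "\<Psi> (?s (twisted_d a (insert v V) f)) = khovanov_d D (\<Psi> (?s f))"
      using P(5)[OF shear_supported[OF f]] by simp
  qed
qed

section \<open>The twist is a combination of squared saddles\<close>

text \<open>The coefficients stay existential, since \<open>untwist\<close> works for arbitrary
  ones. This also makes the property closed under sums, which both walks below require.\<close>

definition square_combination :: "(('d, 'k) chain \<Rightarrow> ('d, 'k) chain) \<Rightarrow> bool" where
  "square_combination T \<longleftrightarrow>
     (\<exists>a. \<forall>f\<in>supported. T f = (\<Sum>v\<in>crossings D. scale (a v) (saddle2 v f)))"

lemma square_combination_cong:
  assumes "square_combination T" "\<And>f. f \<in> supported \<Longrightarrow> U f = T f"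
  shows "square_combination U"
  using assms(1) unfolding square_combination_def by (simp only: assms(2) cong: ball_cong)

lemma square_combination_zero: "square_combination (\<lambda>f. 0)"
  unfolding square_combination_def by (rule exI[of _ "\<lambda>v. 0"]) simp

lemma square_combination_add:
  assumes "square_combination T" "square_combination U"
  shows "square_combination (\<lambda>f. T f + U f)"
proof -
  obtain a b where ab: "\<And>f. f \<in> supported \<Longrightarrow> T f = (\<Sum>v\<in>crossings D. scale (a v) (saddle2 v f))"
    "\<And>f. f \<in> supported \<Longrightarrow> U f = (\<Sum>v\<in>crossings D. scale (b v) (saddle2 v f))"
    using assms unfolding square_combination_def by blast
  show ?thesis unfolding square_combination_def
    by (intro exI[of _ "\<lambda>v. a v + b v"] ballI) (simp only: add_scale sum.distrib ab)
qed

lemma square_combination_scale: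
  assumes "square_combination T"
  shows "square_combination (\<lambda>f. scale c (T f))"
proof -
  obtain a where a: "\<And>f. f \<in> supported \<Longrightarrow> T f = (\<Sum>v\<in>crossings D. scale (a v) (saddle2 v f))"
    using assms unfolding square_combination_def by blast
  show ?thesis unfolding square_combination_def
    by (intro exI[of _ "\<lambda>v. c * a v"] ballI) (simp only: a scale_sum scale_scale)
qed

lemma square_combination_sum:
  assumes "finite I" "\<And>i. i \<in> I \<Longrightarrow> square_combination (T i)"
  shows "square_combination (\<lambda>f. \<Sum>i\<in>I. T i f)"
  using assms
proof (induction I)
  case empty
  then show ?case by (simp only: sum.empty square_combination_zero)
next
  case (insert i I)
  have "square_combination (\<lambda>f. T i f + (\<Sum>i\<in>I. T i f))"
    using insert by (intro square_combination_add) auto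
  then show ?case by (simp only: sum.insert[OF insert.hyps])
qed

lemma square_combination_saddle2:
  assumes "v \<in> crossings D"
  shows "square_combination (saddle2 v)"
  unfolding square_combination_def
proof (intro exI[of _ "\<lambda>u. if u = v then 1 else 0"] ballI)
  fix f :: "('d, 'k) chain"
  have "(\<Sum>u\<in>crossings D. scale (if u = v then 1 else 0) (saddle2 u f)) =
      (\<Sum>u\<in>crossings D. if u = v then saddle2 v f else 0)"
    by (rule sum.cong) auto
  also have "\<dots> = saddle2 v f" using assms finite_crossings by simp
  finally show "saddle2 v f = (\<Sum>u\<in>crossings D. scale (if u = v then 1 else 0) (saddle2 u f))" ..
qed

lemma square_combination_dart_mult:
  assumes "d \<in> darts D"
  shows "square_combination (dart_mult d)"
proof -
  have "d \<in> darts D \<and> square_combination (dart_mult d)"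
    using single_component[OF assms]
  proof induction
    case base
    have "dart_mult (basedart D) f = 0" for f :: "('d, 'k) chain"
    proof (rule ext, clarify)
      fix s X
      have "\<not> ((s, X) \<in> generators D \<and> circle s (basedart D) \<in> X)"
        unfolding generators_iff using self_in_circle by blast
      then show "dart_mult (basedart D) f (s, X) = 0 (s, X)" by (auto simp: dart_mult_def)
    qed
    then show ?case using base_in square_combination_cong[OF square_combination_zero] by blast
  next
    case (step y z)
    then have y: "y \<in> darts D" "square_combination (dart_mult y)" by auto
    have same: "square_combination (dart_mult z)" if "\<And>s. circle s z = circle s y"
    proof -
      have "dart_mult z = (dart_mult y :: ('d, 'k) chain \<Rightarrow> _)"
by (intro ext, clarify) (simp add: dart_mult_def that)
      then show ?thesis using y by simp
    qed
    consider "z = flip D y" | "y \<in> base_darts D" "z = rot D y"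
      | "y \<in> crossing_darts D" "z = opp y"
      using step.hyps(2) y by (auto simp: strand_rel_def straight_def crossing_darts_def split: if_splits)
    then show ?case
    proof cases
      case 1
      then show ?thesis using same circle_flip[OF y(1)] flip_closed[OF y(1)] by simp
    next
      case 2
      then have "circle s z = circle s y" for s using circle_smooth[OF y(1), of s] smooth_base by simp
      then show ?thesis using same 2 rot_in y by simp
    next
      case 3
      let ?v = "orbit (rot D) y"
      have "square_combination (\<lambda>f. dart_mult y f + saddle2 ?v f)"
        by (intro square_combination_add y(2) square_combination_saddle2 crossing_in[OF 3(1)])
      then have "square_combination (dart_mult z)"
        \<comment> \<open>With \<open>y\<close> and \<open>z\<close> opposite, x_y + (x_y + x_z) =
          x_z in characteristic 2.\<close>
        by (rule square_combination_cong)
          (simp only: saddle_square[OF 3(1)] opposite_mult_def 3(2) add_self_left)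
      then show ?thesis using 3 y rot_in by simp
    qed
  qed
  then show ?thesis by simp
qed

text \<open>The coefficient of the variable of the region \<open>r\<close> in
  \<open>twist\<close>.\<close>

definition region_twist :: "'d set \<Rightarrow> ('d, 'k) chain \<Rightarrow> ('d, 'k) chain" where
  "region_twist r f = (\<lambda>(s, X). if (s, X) \<in> generators D
     then (\<Sum>c\<in>free_circles D s. if r \<in> far_regions D s c then x_mult c f (s, X) else 0) else 0)"

text \<open>By \<open>far_regions_flip\<close>, crossing \<open>d\<close> changes sides only with
  respect to the circle through \<open>d\<close>. If that circle carries the basepoint, it does not
  occur in the sum, and \<open>dart_mult d\<close> is 0 there as well.\<close>

lemma region_twist_flip:
  assumes d: "d \<in> darts D"
  shows "region_twist (region D (flip D d)) f = region_twist (region D d) f + dart_mult d f"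
proof (rule ext, clarify)
  fix s X
  show "region_twist (region D (flip D d)) f (s, X) = (region_twist (region D d) f + dart_mult d f) (s, X)"
  proof (cases "(s, X) \<in> generators D")
    case False
    then show ?thesis by (simp add: region_twist_def dart_mult_def)
  next
    case g: True
    let ?x = "\<lambda>c. x_mult c f (s, X)"
    have X: "X \<subseteq> free_circles D s" using g by (simp add: generators_def)
    have split: "(if region D (flip D d) \<in> far_regions D s c then ?x c else 0) =
      (if region D d \<in> far_regions D s c then ?x c else 0) + (if c = circle s d then ?x c else 0)"
      if "c \<in> free_circles D s" for c
    proof -
      have "c = circle s d \<longleftrightarrow> d \<in> c"
        using that circle_closed(4)[of c s d] self_in_circle by (auto simp: free_circles_def)
      then show ?thesis using far_regions_flip[OF that d] add_self[of "?x c"] by auto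
    qed
    have "(\<Sum>c\<in>free_circles D s. if c = circle s d then ?x c else 0) =
      (if circle s d \<in> free_circles D s then ?x (circle s d) else 0)"
      using finite_free_circles by simp
    also have "\<dots> = dart_mult d f (s, X)"
      using g X by (auto simp: dart_mult_def x_mult_def)
    finally have "(\<Sum>c\<in>free_circles D s. if c = circle s d then ?x c else 0) = dart_mult d f (s, X)" .
    then show ?thesis using g split by (simp add: region_twist_def sum.distrib)
  qed
qed

text \<open>Walk from the region at the basepoint, which is far from no circle and so contributes 0;
  each crossed edge adds one \<open>dart_mult\<close>.\<close>

lemma square_combination_region_twist:
  assumes "r \<in> regions D"
  shows "square_combination (region_twist r)"
proof -
  obtain e where e: "e \<in> darts D" "r = region D e" using assms by (auto simp: regions_def)
  show ?thesis unfolding e(2)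
  proof (rule region_connected[where P = "\<lambda>r. square_combination (region_twist r)", OF _ base_in e(1)])
    show "square_combination (region_twist (region D (flip D d)))"
      if "d \<in> darts D" "square_combination (region_twist (region D d))" for d
      using square_combination_add[OF that(2) square_combination_dart_mult[OF that(1)]]
      by (rule square_combination_cong) (rule region_twist_flip[OF that(1)])
    have "region_twist (region D (basedart D)) f = 0" for f
      by (rule ext) (auto simp: region_twist_def far_regions_base)
    then show "square_combination (region_twist (region D (basedart D)))"
      using square_combination_cong[OF square_combination_zero] by blast
  qed
qed

lemma twist_region_twist: "twist D w f = (\<Sum>r\<in>regions D. scale (w r) (region_twist r f))"
proof (rule ext, clarify)
  fix s X
  show "twist D w f (s, X) = (\<Sum>r\<in>regions D. scale (w r) (region_twist r f)) (s, X)"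
  proof (cases "(s, X) \<in> generators D")
    case False
    then show ?thesis by (simp add: sum_fun_apply scale_def region_twist_def twist_def)
  next
    case True
    let ?x = "\<lambda>c. x_mult c f (s, X)"
    have weight: "circle_weight D w s c = (\<Sum>r\<in>regions D. if r \<in> far_regions D s c then w r else 0)" for c
    proof -
      have "far_regions D s c = regions D \<inter> {r. r \<in> far_regions D s c}"
        by (auto simp: far_regions_def)
      then show ?thesis
        unfolding circle_weight_def by (metis sum.inter_restrict[OF finite_regions, of w "far_regions D s c"] inf.commute Collect_mem_eq)
    qed
    have "twist D w f (s, X) =
      (\<Sum>c\<in>free_circles D s. \<Sum>r\<in>regions D. (if r \<in> far_regions D s c then w r else 0) * ?x c)"
      using True by (simp add: twist_def weight sum_distrib_right)
    also have "\<dots> = (\<Sum>r\<in>regions D. \<Sum>c\<in>free_circles D s. (if r \<in> far_regions D s c then w r else 0) * ?x c)"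
      by (rule sum.swap)
    also have "\<dots> = (\<Sum>r\<in>regions D. w r * region_twist r f (s, X))"
      using True by (auto simp: region_twist_def sum_distrib_left intro!: sum.cong)
    finally show ?thesis by (simp add: sum_fun_apply scale_def)
  qed
qed

theorem graded_iso_twisted:
  "graded_iso (twisted_homology D w) (reduced_khovanov_homology D :: int \<Rightarrow> ('k, ('d, 'k) chain set) module)"
proof -
  have "square_combination (twist D w)"
    by (rule square_combination_cong[OF _ twist_region_twist])
      (intro square_combination_sum finite_regions square_combination_scale square_combination_region_twist)
  then obtain a where "\<And>f. f \<in> supported \<Longrightarrow> twist D w f = (\<Sum>v\<in>crossings D. scale (a v) (saddle2 v f))"
    unfolding square_combination_def by blast
  then have T: "khovanov_d D f + twist D w f = twisted_d a (crossings D) f" if "f \<in> supported" for f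
    using that by (simp add: twisted_d_def)
  obtain \<Psi> where P: "linear_op \<Psi>" "inj_on \<Psi> supported" "\<And>k. \<Psi> ` chains D k = chains D k"
    "\<And>f. f \<in> supported \<Longrightarrow> \<Psi> (twisted_d a (crossings D) f) = khovanov_d D (\<Psi> f)"
    using untwist[OF finite_crossings subset_refl, of a] by blast
  show ?thesis
    unfolding twisted_homology_def reduced_khovanov_homology_def
    by (rule graded_iso_homology[OF P(1-3)]) (simp_all only: T P(4) twisted_d_supported)
qed

end

section \<open>Specialization to rational functions over the field with two elements\<close>

lemma ratfun_char2: "(1 :: 'r::linorder ratfun) + 1 = 0"
proof -
  have bit: "b + b = 0" for b :: bit by (cases b) simp_all
  have "(1 :: ('r \<Rightarrow>\<^sub>0 nat) \<Rightarrow>\<^sub>0 bit) + 1 = 0"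
    by (rule poly_mapping_eqI) (simp only: lookup_add bit lookup_zero)
  moreover have "(1 :: 'r ratfun) + 1 = Fract (1 + 1) 1"
    by (simp add: One_fract_def del: one_add_one)
  ultimately show ?thesis by (simp add: Zero_fract_def del: one_add_one)
qed

theorem mainTheorem3:
  fixes D :: "'d diagram"
    and \<rho> :: "'d set \<Rightarrow> 'r::{finite, linorder}"
  assumes "knot_diagram D"
    and "bij_betw \<rho> (regions D) UNIV"
  shows "graded_iso
    (twisted_homology D (\<lambda>r. ratfun_var (\<rho> r)))
    (reduced_khovanov_homology D :: int \<Rightarrow> ('r ratfun, ('d, 'r ratfun) chain set) module)"
proof -
  interpret char2_knot_diagram D "\<lambda>r. ratfun_var (\<rho> r)"
    using assms(1) ratfun_char2 by (intro char2_knot_diagram.intro char2_knot_diagram_axioms.intro)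
  show ?thesis by (rule graded_iso_twisted)
qed

end
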